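(* Let $\sim$ be a compatible relation on the boundary $V_0$ of a p.c.f. self-similar set $K$, let $V_0=\bigcup_{i=1}^sJ_i$ be the decomposition into its equivalence classes, and let $\{J_i^*\}_{i=1}^s$ be the family of boundary classes in $V_*$ ($J_i^*\supset J_i$). Then the closures $\{\overline{J_i^*}\}_{i=1}^s$ are the attractors of a graph directed system, and $\dim_H(\overline{J_i^*})=\dim_B(\overline{J_i^*})$ for each $i$ (Hausdorff and box dimension). The non-boundary classes in $V_*$ are finite unions of contractive similitude images of members of $\{J_i^*\}_{i=1}^s$.
   Context: **P.c.f. setting.** $\{F_i\}_{i=1}^N$ is an IFS on $\mathbb R^d$, $F_i(x)=\rho(x-b_i)+b_i$, $0<\rho<1$, and $K=\bigcup_{i=1}^NF_i(K)$ is the nonempty compact self-similar set, assumed connected. For a word $\omega=\omega_1\cdots\omega_n\in\{1,\dots,N\}^n$, $|\omega|=n$, put $F_\omega=F_{\omega_1}\circ\cdots\circ F_{\omega_n}$, $K_\omega=F_\omega(K)$. Let $\pi:\{1,\dots,N\}^{\infty}\to K$ be $\{\pi(\omega)\}=\bigcap_nK_{\omega_1\cdots\omega_n}$, $\tau$ the left shift, $\mathcal C=\pi^{-1}(\bigcup_{i<j}(K_i\cap K_j))$ and $\mathcal P=\bigcup_{m\ge1}\tau^m(\mathcal C)$. The IFS (and $K$) is p.c.f. if $\mathcal P$ is finite. The boundary is $V_0=\pi(\mathcal P)$, assumed to have at least two points; $V_n=\bigcup_iF_i(V_{n-1})$, $V_*=\bigcup_nV_n$. **Compatible relations.** Let $\sim\,=\,\sim_0$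 be an equivalence relation on $V_0$ with at least two classes. Let $\sim_n$ be the smallest equivalence relation on $V_n$ such that (1) $x\sim_{n-1}y$ in $V_{n-1}$ implies $x\sim_ny$; (2) $x\sim_{n-1}y$ in $V_{n-1}$ implies $F_i(x)\sim_nF_i(y)$ for $1\le i\le N$. The relation $\sim$ is compatible if for all $n\ge0$ and $x,y\in V_n$: $x\sim_ny$ iff $x\sim_{n+1}y$. It then induces an equivalence relation $\sim$ on $V_*$ ($x\sim y$ iff $x\sim_ny$ for $n$ with $x,y\in V_n$). An equivalence class $J$ of $V_n$ or $V_*$ is a boundary class if $J\cap V_0\ne\emptyset$ and a non-boundary class otherwise. **Graph directed system.** Finite sets $\Gamma_{i,j}$ ($1\le i,j\le s$) of edges together with contractive similitudes $\{F_e:e\in\Gamma_{i,j}\}$; its attractors are nonempty compact sets $K_1,\dots,K_s$ with $K_i=\bigcup_{j}\bigcup_{e\in\Gamma_{i,j}}F_e(K_j)$. *)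

theory Defs
  imports "HOL-Analysis.Analysis" "HOL-Library.Stream"
begin

section \<open>Hausdorff and box dimension\<close>

text \<open>The term for \<open>U = {}\<close> is \<open>0\<close> and a nonempty set contributes \<open>1\<close> when \<open>s = 0\<close>, so that
  the \<open>0\<close>-dimensional measure counts points.\<close>

definition diam_pow :: "real \<Rightarrow> 'a::metric_space set \<Rightarrow> ennreal" where
  "diam_pow s U = (if U = {} then 0 else if s = 0 then 1 else ennreal (diameter U powr s))"

text \<open>Boundedness is required explicitly since \<^const>\<open>diameter\<close> is meaningless on unbounded sets.\<close>

definition hausdorff_premeasure :: "real \<Rightarrow> real \<Rightarrow> 'a::metric_space set \<Rightarrow> ennreal" where
  "hausdorff_premeasure s \<delta> E =
     (INF U \<in> {U :: nat \<Rightarrow> 'a set. E \<subseteq> (\<Union>k. U k) \<and> (\<forall>k. bounded (U k) \<and> diameter (U k) \<le> \<delta>)}.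
        (\<Sum>k. diam_pow s (U k)))"

definition hausdorff_measure :: "real \<Rightarrow> 'a::metric_space set \<Rightarrow> ennreal" where
  "hausdorff_measure s E = (SUP \<delta> \<in> {0<..}. hausdorff_premeasure s \<delta> E)"

definition hausdorff_dim :: "'a::metric_space set \<Rightarrow> ereal" where
  "hausdorff_dim E = Inf (ereal ` {s. 0 \<le> s \<and> hausdorff_measure s E = 0})"

definition covering_number :: "'a::metric_space set \<Rightarrow> real \<Rightarrow> nat" where
  "covering_number E \<delta> =
     Inf (card ` {\<U>. finite \<U> \<and> E \<subseteq> \<Union>\<U> \<and> (\<forall>U\<in>\<U>. bounded U \<and> diameter U \<le> \<delta>)})"

definition lower_box_dim :: "'a::metric_space set \<Rightarrow> ereal" where
  "lower_box_dim E = Liminf (at_right 0) (\<lambda>\<delta>. ereal (ln (real (covering_number E \<delta>)) / - ln \<delta>))"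

definition upper_box_dim :: "'a::metric_space set \<Rightarrow> ereal" where
  "upper_box_dim E = Limsup (at_right 0) (\<lambda>\<delta>. ereal (ln (real (covering_number E \<delta>)) / - ln \<delta>))"

definition has_box_dim :: "'a::metric_space set \<Rightarrow> ereal \<Rightarrow> bool" where
  "has_box_dim E d \<longleftrightarrow> lower_box_dim E = d \<and> upper_box_dim E = d"


section \<open>Graph directed systems\<close>

definition contractive_similitude :: "('a::metric_space \<Rightarrow> 'a) \<Rightarrow> bool" where
  "contractive_similitude f \<longleftrightarrow> (\<exists>r. 0 < r \<and> r < 1 \<and> (\<forall>x y. dist (f x) (f y) = r * dist x y))"

text \<open>Since all edge sets are finite, edges may be labelled by natural numbers.\<close>

definition graph_directed_system ::
    "nat \<Rightarrow> (nat \<Rightarrow> nat \<Rightarrow> nat set) \<Rightarrow> (nat \<Rightarrow> 'a::metric_space \<Rightarrow> 'a) \<Rightarrow> bool" where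
  "graph_directed_system s \<Gamma> f \<longleftrightarrow>
     (\<forall>i\<in>{1..s}. \<forall>j\<in>{1..s}. finite (\<Gamma> i j) \<and> (\<forall>e\<in>\<Gamma> i j. contractive_similitude (f e)))"

definition gds_attractors ::
    "nat \<Rightarrow> (nat \<Rightarrow> nat \<Rightarrow> nat set) \<Rightarrow> (nat \<Rightarrow> 'a::metric_space \<Rightarrow> 'a) \<Rightarrow> (nat \<Rightarrow> 'a set) \<Rightarrow> bool" where
  "gds_attractors s \<Gamma> f A \<longleftrightarrow>
     (\<forall>i\<in>{1..s}. A i \<noteq> {} \<and> compact (A i) \<and>
        A i = (\<Union>j\<in>{1..s}. \<Union>e\<in>\<Gamma> i j. f e ` A j))"


section \<open>Post-critically finite self-similar sets\<close>

text \<open>An IFS is a family of maps \<open>F i\<close> with \<open>i \<in> {1..N}\<close>; for a finite word \<open>w\<close> the map \<open>F\<^sub>w\<close> is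
  \<^term>\<open>foldr F w\<close>. Infinite words are streams, with \<^term>\<open>sdrop m\<close> the \<open>m\<close>-th iterate of the left
  shift.\<close>

definition self_similar_set :: "nat \<Rightarrow> (nat \<Rightarrow> 'a::metric_space \<Rightarrow> 'a) \<Rightarrow> 'a set \<Rightarrow> bool" where
  "self_similar_set N F K \<longleftrightarrow> K \<noteq> {} \<and> compact K \<and> K = (\<Union>i\<in>{1..N}. F i ` K)"

definition coding :: "(nat \<Rightarrow> 'a \<Rightarrow> 'a) \<Rightarrow> 'a set \<Rightarrow> nat stream \<Rightarrow> 'a" where
  "coding F K \<omega> = the_elem (\<Inter>n. foldr F (stake n \<omega>) ` K)"

definition critical :: "nat \<Rightarrow> (nat \<Rightarrow> 'a \<Rightarrow> 'a) \<Rightarrow> 'a set \<Rightarrow> nat stream set" where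
  "critical N F K =
     {\<omega> \<in> streams {1..N}. coding F K \<omega> \<in> (\<Union>j\<in>{1..N}. \<Union>i\<in>{1..<j}. F i ` K \<inter> F j ` K)}"

definition post_critical :: "nat \<Rightarrow> (nat \<Rightarrow> 'a \<Rightarrow> 'a) \<Rightarrow> 'a set \<Rightarrow> nat stream set" where
  "post_critical N F K = (\<Union>m\<in>{1..}. sdrop m ` critical N F K)"

definition pcf :: "nat \<Rightarrow> (nat \<Rightarrow> 'a \<Rightarrow> 'a) \<Rightarrow> 'a set \<Rightarrow> bool" where
  "pcf N F K \<longleftrightarrow> finite (post_critical N F K)"

primrec V :: "nat \<Rightarrow> (nat \<Rightarrow> 'a \<Rightarrow> 'a) \<Rightarrow> 'a set \<Rightarrow> nat \<Rightarrow> 'a set" where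
  "V N F K 0 = coding F K ` post_critical N F K"
| "V N F K (Suc n) = (\<Union>i\<in>{1..N}. F i ` V N F K n)"

definition Vstar :: "nat \<Rightarrow> (nat \<Rightarrow> 'a \<Rightarrow> 'a) \<Rightarrow> 'a set \<Rightarrow> 'a set" where
  "Vstar N F K = (\<Union>n. V N F K n)"


section \<open>Compatible relations\<close>

text \<open>The intersection of all equivalence relations with the two closure properties is the smallest
  one.\<close>

primrec sim :: "nat \<Rightarrow> (nat \<Rightarrow> 'a \<Rightarrow> 'a) \<Rightarrow> 'a set \<Rightarrow> 'a rel \<Rightarrow> nat \<Rightarrow> 'a rel" where
  "sim N F K R 0 = R"
| "sim N F K R (Suc n) =
     \<Inter>{S. equiv (V N F K (Suc n)) S \<and>
         (\<forall>(x, y) \<in> sim N F K R n. (x, y) \<in> S) \<and>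
         (\<forall>(x, y) \<in> sim N F K R n. \<forall>i\<in>{1..N}. (F i x, F i y) \<in> S)}"

definition compatible :: "nat \<Rightarrow> (nat \<Rightarrow> 'a \<Rightarrow> 'a) \<Rightarrow> 'a set \<Rightarrow> 'a rel \<Rightarrow> bool" where
  "compatible N F K R \<longleftrightarrow>
     equiv (V N F K 0) R \<and> card (V N F K 0 // R) \<ge> 2 \<and>
     (\<forall>n. \<forall>x\<in>V N F K n. \<forall>y\<in>V N F K n.
        (x, y) \<in> sim N F K R n \<longleftrightarrow> (x, y) \<in> sim N F K R (Suc n))"

definition simstar :: "nat \<Rightarrow> (nat \<Rightarrow> 'a \<Rightarrow> 'a) \<Rightarrow> 'a set \<Rightarrow> 'a rel \<Rightarrow> 'a rel" where
  "simstar N F K R =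
     {(x, y). \<exists>n. x \<in> V N F K n \<and> y \<in> V N F K n \<and> (x, y) \<in> sim N F K R n}"

definition boundary_classes :: "nat \<Rightarrow> (nat \<Rightarrow> 'a \<Rightarrow> 'a) \<Rightarrow> 'a set \<Rightarrow> 'a rel \<Rightarrow> 'a set set" where
  "boundary_classes N F K R = {J \<in> Vstar N F K // simstar N F K R. J \<inter> V N F K 0 \<noteq> {}}"

definition nonboundary_classes :: "nat \<Rightarrow> (nat \<Rightarrow> 'a \<Rightarrow> 'a) \<Rightarrow> 'a set \<Rightarrow> 'a rel \<Rightarrow> 'a set set" where
  "nonboundary_classes N F K R = {J \<in> Vstar N F K // simstar N F K R. J \<inter> V N F K 0 = {}}"

end

theory Submission
  imports Defs
begin

text \<open>
Call the maps \<open>F\<^sub>w\<close> with \<open>w\<close> a word of length \<open>n\<close>, and also their images of \<open>K\<close>, the cells of level \<open>n\<close>.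
Everything rests on one property of the finite set \<open>V\<^sub>0\<close> (lemma \<open>meeting_point_in_V0\<close>): if
\<open>w\<close> and \<open>v\<close> are different words of equal length and \<open>F\<^sub>w x = F\<^sub>v y\<close> with \<open>x, y \<in> K\<close>, then \<open>x\<close> and
\<open>y\<close> belong to \<open>V\<^sub>0\<close>.

The classes. Each pair that generates the relation lies in one first-level cell or in \<open>V\<^sub>0\<close>. So if
a class \<open>D\<close> avoids \<open>V\<^sub>0\<close>, then no generating pair leads out of \<open>F\<^sub>i(D)\<close>, which is again a whole class
avoiding \<open>V\<^sub>0\<close> (\<open>nonboundary_image\<close>). Every class is a union of images \<open>F\<^sub>i(D')\<close> of classes; by the
preceding remark it is either a single \<open>F\<^sub>i(D')\<close> with \<open>D'\<close> non-boundary, or it is a union of images of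
boundary classes, of which there are finitely many (\<open>class_decomposition\<close>). Boundary classes are of the
second kind, and the closure of such a finite union is the union of the images of the closures: this is
the graph directed system, with an edge labelled \<open>k\<close> from \<open>i\<close> to \<open>j\<close> whenever
\<open>F\<^sub>k(J\<^sub>j\<^sup>*) \<subseteq> J\<^sub>i\<^sup>*\<close>. From a non-boundary class one peels off maps \<open>F\<^sub>i\<close> until a class of the second kind
remains.

The dimensions. The graph need not be strongly connected, so overlaps of the pieces must be controlled.
All \<open>F\<^sub>i\<close> are homotheties of the same ratio \<open>\<rho>\<close>, hence two cells of level \<open>n\<close> differ by a translation, and if
they meet, by a translation in the finite set \<open>\<rho>\<^sup>n(V\<^sub>0 - V\<^sub>0)\<close>. Up to similarity there are
finitely many pairs of children of meeting cells, and disjoint children are therefore at a distance of at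
least \<open>c\<rho>\<^sup>n\<close>. Two cells of level \<open>n\<close> at a distance of order \<open>\<rho>\<^sup>n\<close> thus have meeting ancestors a bounded
number of levels above, and a set of diameter of order \<open>\<rho>\<^sup>n\<close> meets a bounded number of cells
of level \<open>n\<close> (\<open>bounded_overlap\<close>).

This makes a form of Falconer's implicit method work. Let \<open>A\<^sub>1, \<dots>, A\<^sub>s\<close> be the attractors and let \<open>A\<^sub>j\<close> have
zero \<open>t\<close>-dimensional Hausdorff measure. Each set of an efficient cover of \<open>A\<^sub>j\<close> is replaced by the boundedly
many cells of comparable size that it meets, which yields a finite cover of \<open>A\<^sub>j\<close> by copies of sets \<open>A\<^sub>k\<close>
whose ratios \<open>r\<close> satisfy \<open>\<Sum>r\<^sup>t \<le> 1\<close> (\<open>null_set_self_cover\<close>). Since \<open>A\<^sub>j\<close> contains these copies, each \<open>A\<^sub>k\<close> that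
occurs is a null set too, so that the covers can be iterated. The outcome is a bound \<open>C\<delta>\<^sup>-\<^sup>t\<close> for the
covering numbers (\<open>covering_number_le_of_self_cover\<close>), and the upper box dimension is at most \<open>t\<close>. Hence
it is at most the Hausdorff dimension, which is at most the lower box dimension for every compact set.
\<close>

(* Keeps the index set {1..N} from being rewritten to {Suc 0..N}. *)
declare One_nat_def [simp del]

section \<open>Words and codes in a homothetic self-similar set\<close>

locale homothetic_ifs =
  fixes N :: nat and \<rho> :: real and b :: "nat \<Rightarrow> 'a::euclidean_space"
    and F :: "nat \<Rightarrow> 'a \<Rightarrow> 'a" and K :: "'a set"
  assumes rho_pos: "0 < \<rho>" and rho_less_1: "\<rho> < 1"
    and F_eq: "\<And>i x. i \<in> {1..N} \<Longrightarrow> F i x = \<rho> *\<^sub>R (x - b i) + b i"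
    and K_self_similar: "self_similar_set N F K"
begin

lemma K_nonempty: "K \<noteq> {}" and K_compact: "compact K"
  and K_eq: "K = (\<Union>i\<in>{1..N}. F i ` K)"
  using K_self_similar unfolding self_similar_set_def by blast+

lemma F_in_K: "i \<in> {1..N} \<Longrightarrow> x \<in> K \<Longrightarrow> F i x \<in> K"
  using K_eq by blast

lemma N_pos: "1 \<le> N"
  using K_eq K_nonempty by (cases N) auto

lemma F_diff: "i \<in> {1..N} \<Longrightarrow> F i x - F i y = \<rho> *\<^sub>R (x - y)"
  by (simp add: F_eq scaleR_right_diff_distrib)

lemma F_inj: "i \<in> {1..N} \<Longrightarrow> F i x = F i y \<longleftrightarrow> x = y"
  using F_diff[of i x y] rho_pos by auto

lemma F_dist: "i \<in> {1..N} \<Longrightarrow> dist (F i x) (F i y) = \<rho> * dist x y"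
  using F_diff[of i x y] rho_pos by (simp add: dist_norm)

lemma F_similitude: "i \<in> {1..N} \<Longrightarrow> contractive_similitude (F i)"
  using F_dist rho_pos rho_less_1 unfolding contractive_similitude_def by blast

lemma F_continuous: "i \<in> {1..N} \<Longrightarrow> continuous_on S (F i)"
proof -
  assume i: "i \<in> {1..N}"
  have "continuous_on S (\<lambda>x. \<rho> *\<^sub>R (x - b i) + b i)"
    by (intro continuous_intros)
  then show ?thesis by (simp add: F_eq[OF i] cong: continuous_on_cong)
qed

definition words :: "nat \<Rightarrow> nat list set" where
  "words n = {w. length w = n \<and> set w \<subseteq> {1..N}}"

lemma words_0 [simp]: "words 0 = {[]}"
  unfolding words_def by auto

lemma words_Suc: "words (Suc n) = {i # w | i w. i \<in> {1..N} \<and> w \<in> words n}"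
proof -
  have "w \<in> words (Suc n) \<longleftrightarrow> (\<exists>i v. w = i # v \<and> i \<in> {1..N} \<and> v \<in> words n)" for w
    unfolding words_def by (cases w) auto
  then show ?thesis by blast
qed

lemma take_words: "w \<in> words n \<Longrightarrow> k \<le> n \<Longrightarrow> take k w \<in> words k"
  unfolding words_def by (auto dest: in_set_takeD)

lemma drop_words: "w \<in> words n \<Longrightarrow> drop k w \<in> words (n - k)"
  unfolding words_def by (auto dest: in_set_dropD)

lemma finite_words: "finite (words n)" and card_words: "card (words n) = N ^ n"
proof -
  have *: "words n = {w. set w \<subseteq> {1..N} \<and> length w = n}"
    unfolding words_def by auto
  show "finite (words n)" "card (words n) = N ^ n"
    unfolding * by (simp_all add: finite_lists_length_eq card_lists_length_eq)
qed

lemma word_diff: "w \<in> words n \<Longrightarrow> foldr F w x - foldr F w y = \<rho> ^ n *\<^sub>R (x - y)"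
  by (induction n arbitrary: w) (auto simp: words_Suc F_diff)

lemma word_eq: "w \<in> words n \<Longrightarrow> foldr F w x = \<rho> ^ n *\<^sub>R x + foldr F w 0"
  using word_diff[of w n x 0] by (simp add: algebra_simps)

lemma word_dist: "w \<in> words n \<Longrightarrow> dist (foldr F w x) (foldr F w y) = \<rho> ^ n * dist x y"
  using word_diff[of w n x y] rho_pos by (simp add: dist_norm)

lemma word_in_K: "w \<in> words n \<Longrightarrow> x \<in> K \<Longrightarrow> foldr F w x \<in> K"
  by (induction n arbitrary: w) (auto simp: words_Suc F_in_K)

lemma word_continuous: "w \<in> words n \<Longrightarrow> continuous_on S (foldr F w)"
proof (induction n arbitrary: w S)
  case (Suc n)
  then obtain i v where "w = i # v" "i \<in> {1..N}" "v \<in> words n"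
    by (auto simp: words_Suc)
  then show ?case
    using continuous_on_compose[of S "foldr F v" "F i"] F_continuous Suc.IH
    by (simp add: o_def)
qed (simp add: continuous_on_id)

lemma stake_words: "\<omega> \<in> streams {1..N} \<Longrightarrow> stake n \<omega> \<in> words n"
proof (induction n arbitrary: \<omega>)
  case (Suc n)
  have "shd \<omega> \<in> {1..N}" "stake n (stl \<omega>) \<in> words n"
    using streams_shd[OF Suc.prems] Suc.IH[OF streams_stl[OF Suc.prems]] by blast+
  then show ?case unfolding words_Suc by simp
qed simp

lemma coding_singleton:
  assumes "\<omega> \<in> streams {1..N}"
  shows "(\<Inter>n. foldr F (stake n \<omega>) ` K) = {coding F K \<omega>}"
proof -
  let ?S = "\<lambda>n. foldr F (stake n \<omega>) ` K"
  have "\<exists>a. \<Inter>(range ?S) = {a}"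
  proof (rule decreasing_closed_nest_sing)
    fix n show "closed (?S n)"
      using compact_continuous_image[OF word_continuous[OF stake_words[OF assms]] K_compact]
      by (rule compact_imp_closed)
  next
    have "?S (Suc n) \<subseteq> ?S n" for n
    proof -
      have "snth \<omega> n \<in> {1..N}"
        using assms by (simp add: streams_iff_snth)
      then show ?thesis
        by (auto simp: stake_Suc F_in_K simp del: stake.simps(2))
    qed
    then show "?S n \<subseteq> ?S m" if "m \<le> n" for m n
      using that by (rule lift_Suc_antimono_le)
  next
    fix \<epsilon> :: real assume "\<epsilon> > 0"
    have "bounded K" using K_compact by (rule compact_imp_bounded)
    have "(\<lambda>n. \<rho> ^ n * diameter K) \<longlonglongrightarrow> 0"
      using rho_pos rho_less_1 by (intro tendsto_mult_left_zero LIMSEQ_power_zero) simp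
    then obtain n where n: "\<rho> ^ n * diameter K < \<epsilon>"
      using \<open>\<epsilon> > 0\<close> by (metis (no_types, lifting) eventually_sequentially order_tendstoD(2) order_refl)
    have "dist x y < \<epsilon>" if xy: "x \<in> ?S n" "y \<in> ?S n" for x y
    proof -
      obtain x' y' where "x' \<in> K" "y' \<in> K" "x = foldr F (stake n \<omega>) x'" "y = foldr F (stake n \<omega>) y'"
        using xy by blast
      then have "dist x y = \<rho> ^ n * dist x' y'" and "dist x' y' \<le> diameter K"
        using word_dist[OF stake_words[OF assms]] diameter_bounded_bound[OF \<open>bounded K\<close>] by auto
      then have "dist x y \<le> \<rho> ^ n * diameter K"
        using rho_pos by (simp add: mult_left_mono)
      then show ?thesis using n by linarith
    qed
    then show "\<exists>n. \<forall>x\<in>?S n. \<forall>y\<in>?S n. dist x y < \<epsilon>" by blast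
  qed (use K_nonempty in simp)
  then obtain a where a: "\<Inter>(range ?S) = {a}" ..
  show ?thesis unfolding coding_def a by simp
qed

lemma coding_eqI:
  assumes "\<omega> \<in> streams {1..N}" "\<And>n. x \<in> foldr F (stake n \<omega>) ` K"
  shows "coding F K \<omega> = x"
proof -
  have "x \<in> (\<Inter>n. foldr F (stake n \<omega>) ` K)" by (rule INT_I) (rule assms(2))
  then show ?thesis unfolding coding_singleton[OF assms(1)] by simp
qed

lemma coding_mem:
  assumes "\<omega> \<in> streams {1..N}" shows "coding F K \<omega> \<in> foldr F (stake n \<omega>) ` K"
proof -
  have "coding F K \<omega> \<in> (\<Inter>n. foldr F (stake n \<omega>) ` K)"
    unfolding coding_singleton[OF assms] by simp
  then show ?thesis by (rule INT_D) simp
qed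

lemma coding_in_K: "\<omega> \<in> streams {1..N} \<Longrightarrow> coding F K \<omega> \<in> K"
  using coding_mem[of \<omega> 0] by simp

lemma coding_SCons:
  assumes "i \<in> {1..N}" "\<omega> \<in> streams {1..N}"
  shows "coding F K (i ## \<omega>) = F i (coding F K \<omega>)"
proof (rule coding_eqI)
  show "i ## \<omega> \<in> streams {1..N}" using assms by (simp add: streams_Stream)
  fix n show "F i (coding F K \<omega>) \<in> foldr F (stake n (i ## \<omega>)) ` K"
  proof (cases n)
    case 0
    have "F i (coding F K \<omega>) \<in> K"
      by (rule F_in_K[OF assms(1) coding_in_K[OF assms(2)]])
    then show ?thesis using 0 by simp
  next
    case (Suc m)
    obtain y where "y \<in> K" "coding F K \<omega> = foldr F (stake m \<omega>) y"
      using coding_mem[OF assms(2), of m] by blast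
    then have "F i (coding F K \<omega>) = foldr F (stake n (i ## \<omega>)) y"
      unfolding Suc by simp
    then show ?thesis using \<open>y \<in> K\<close> by blast
  qed
qed

lemma coding_shift:
  "w \<in> words n \<Longrightarrow> \<omega> \<in> streams {1..N} \<Longrightarrow>
     w @- \<omega> \<in> streams {1..N} \<and> coding F K (w @- \<omega>) = foldr F w (coding F K \<omega>)"
proof (induction n arbitrary: w)
  case (Suc n)
  then obtain i v where "w = i # v" "i \<in> {1..N}" "v \<in> words n"
    unfolding words_Suc by blast
  then show ?case
    using Suc.IH[OF _ Suc.prems(2), of v] coding_SCons[of i "v @- \<omega>"]
    by (metis comp_apply foldr.simps(2) shift.simps(2) streams_Stream)
qed simp

text \<open>A code of \<open>x\<close> is obtained by choosing repeatedly a first-level cell and the preimage of the point in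
  it.\<close>

lemma coding_surj:
  assumes "x \<in> K" shows "\<exists>\<omega>\<in>streams {1..N}. coding F K \<omega> = x"
proof -
  have "\<forall>x\<in>K. \<exists>i y. i \<in> {1..N} \<and> y \<in> K \<and> x = F i y"
    using K_eq by blast
  then obtain I Y where IY: "\<And>x. x \<in> K \<Longrightarrow> I x \<in> {1..N} \<and> Y x \<in> K \<and> x = F (I x) (Y x)"
    by metis
  define \<omega> where "\<omega> x = smap I (siterate Y x)" for x
  have step: "\<omega> x = I x ## \<omega> (Y x)" for x
    unfolding \<omega>_def by (subst siterate.code) simp
  have "(Y ^^ n) x \<in> K" if "x \<in> K" for n x
    using that IY by (induction n) auto
  then have str: "\<omega> x \<in> streams {1..N}" if "x \<in> K" for x
    unfolding streams_iff_snth \<omega>_def using that IY by simp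
  have "x \<in> foldr F (stake n (\<omega> x)) ` K" if "x \<in> K" for n x
    using that
  proof (induction n arbitrary: x)
    case (Suc n)
    then obtain y where y: "y \<in> K" "Y x = foldr F (stake n (\<omega> (Y x))) y" using IY by blast
    have "x = F (I x) (Y x)" using IY Suc.prems by blast
    also have "\<dots> = F (I x) (foldr F (stake n (\<omega> (Y x))) y)" using y(2) by simp
    also have "\<dots> = foldr F (stake (Suc n) (\<omega> x)) y" by (subst (2) step) simp
    finally show ?case using y(1) by (rule image_eqI)
  qed simp
  then show ?thesis using coding_eqI[OF str] str assms by blast
qed

section \<open>Cells of equal level meet only in boundary points\<close>

abbreviation V0 :: "'a set" where "V0 \<equiv> V N F K 0"

lemma post_critical_streams: "post_critical N F K \<subseteq> streams {1..N}"
  unfolding post_critical_def critical_def by (auto simp: streams_iff_snth sdrop_snth)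

lemma post_critical_stl: "\<omega> \<in> post_critical N F K \<Longrightarrow> stl \<omega> \<in> post_critical N F K"
  unfolding post_critical_def by (fastforce simp: sdrop_stl[symmetric] simp flip: sdrop.simps(2))

text \<open>The post-critical set is invariant under the shift, so that \<open>V0\<close> is covered by its images.\<close>

lemma V_subset_Suc: "V N F K n \<subseteq> V N F K (Suc n)"
proof (induction n)
  case 0
  show ?case
  proof
    fix x assume "x \<in> V0"
    then obtain \<omega> where \<omega>: "\<omega> \<in> post_critical N F K" "x = coding F K \<omega>" by auto
    then have "\<omega> \<in> streams {1..N}" using post_critical_streams by blast
    then have "shd \<omega> \<in> {1..N}" "stl \<omega> \<in> streams {1..N}"
      by (rule streams_shd, rule streams_stl)
    moreover from this have "x = F (shd \<omega>) (coding F K (stl \<omega>))"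
      using coding_SCons[of "shd \<omega>" "stl \<omega>"] \<omega>(2) by simp
    ultimately show "x \<in> V N F K (Suc 0)"
      using post_critical_stl[OF \<omega>(1)] unfolding V.simps by (intro UN_I[of "shd \<omega>"]) simp_all
  qed
next
  case (Suc n) then show ?case by fastforce
qed

lemma V_subset_K: "V N F K n \<subseteq> K"
proof (induction n)
  case 0 show ?case using post_critical_streams coding_in_K by auto
next
  case (Suc n) then show ?case using F_in_K by auto
qed

text \<open>The two words differ at some first letter; after removal of the common prefix, a code of \<open>x\<close>
  prefixed by the rest of \<open>w\<close> is a critical code, so the code of \<open>x\<close> itself is post-critical.\<close>

lemma meeting_point_in_V0:
  assumes "w \<in> words n" "v \<in> words n" "w \<noteq> v" "x \<in> K" "y \<in> K" "foldr F w x = foldr F v y"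
  shows "x \<in> V0"
  using assms
proof (induction n arbitrary: w v)
  case (Suc n)
  obtain i w' j v' where w: "w = i # w'" "i \<in> {1..N}" "w' \<in> words n"
    and v: "v = j # v'" "j \<in> {1..N}" "v' \<in> words n"
    using Suc.prems by (auto simp: words_Suc)
  show ?case
  proof (cases "i = j")
    case True
    then show ?thesis using Suc.IH[of w' v'] Suc.prems w v F_inj by auto
  next
    case False
    obtain \<omega> where \<omega>: "\<omega> \<in> streams {1..N}" "coding F K \<omega> = x"
      using coding_surj \<open>x \<in> K\<close> by blast
    define z where "z = foldr F w x"
    have "z = F i (foldr F w' x)" "z = F j (foldr F v' y)"
      using Suc.prems w(1) v(1) by (simp_all add: z_def)
    then have "z \<in> F i ` K" "z \<in> F j ` K"
      using word_in_K[OF w(3) \<open>x \<in> K\<close>] word_in_K[OF v(3) \<open>y \<in> K\<close>] by (metis image_eqI)+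
    have "i < j \<or> j < i" using False by arith
    then have "z \<in> (\<Union>j\<in>{1..N}. \<Union>i\<in>{1..<j}. F i ` K \<inter> F j ` K)"
    proof
      assume "i < j"
      then have "i \<in> {1..<j}" using w(2) by simp
      with v(2) show ?thesis using \<open>z \<in> F i ` K\<close> \<open>z \<in> F j ` K\<close> by blast
    next
      assume "j < i"
      then have "j \<in> {1..<i}" using v(2) by simp
      with w(2) show ?thesis using \<open>z \<in> F i ` K\<close> \<open>z \<in> F j ` K\<close> by blast
    qed
    then have "w @- \<omega> \<in> critical N F K"
      unfolding critical_def z_def mem_Collect_eq
      using coding_shift[OF Suc.prems(1) \<omega>(1)] \<omega>(2) by metis
    moreover have "sdrop (Suc n) (w @- \<omega>) = \<omega>"
      using Suc.prems(1) by (simp add: words_def sdrop_shift)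
    ultimately have "\<omega> \<in> post_critical N F K"
      unfolding post_critical_def
      by (intro UN_I[of "Suc n"] image_eqI[of _ _ "w @- \<omega>"]) simp_all
    then show ?thesis using \<omega>(2) by (simp add: image_iff) metis
  qed
qed simp

lemma first_level_meeting_point_in_V0:
  assumes "i \<in> {1..N}" "j \<in> {1..N}" "i \<noteq> j" "x \<in> K" "y \<in> K" "F i x = F j y"
  shows "x \<in> V0"
  using meeting_point_in_V0[of "[i]" 1 "[j]" x y] assms by (auto simp: words_def)

end

section \<open>Bounded overlap of cells of equal level\<close>

context homothetic_ifs
begin

definition cells :: "nat \<Rightarrow> ('a \<Rightarrow> 'a) set" where
  "cells n = foldr F ` words n"

lemma cells_0 [simp]: "cells 0 = {id}"
  unfolding cells_def by (auto simp: id_def)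

lemma finite_cells: "finite (cells n)"
  unfolding cells_def by (simp add: finite_words)

lemma card_cells: "card (cells n) \<le> N ^ n"
  unfolding cells_def using card_image_le[OF finite_words] by (simp add: card_words)

lemma cells_SucI: "i \<in> {1..N} \<Longrightarrow> f \<in> cells n \<Longrightarrow> F i \<circ> f \<in> cells (Suc n)"
proof -
  assume i: "i \<in> {1..N}" and "f \<in> cells n"
  then obtain w where w: "w \<in> words n" "f = foldr F w" unfolding cells_def by auto
  have "F i \<circ> f = foldr F (i # w)" using w(2) by (simp add: fun_eq_iff)
  moreover have "i # w \<in> words (Suc n)" using i w(1) unfolding words_Suc by simp
  ultimately show "F i \<circ> f \<in> cells (Suc n)" unfolding cells_def by (rule image_eqI)
qed

lemma cell_eq: "f \<in> cells n \<Longrightarrow> f x = \<rho> ^ n *\<^sub>R x + f 0"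
  unfolding cells_def using word_eq by blast

lemma cell_dist: "f \<in> cells n \<Longrightarrow> dist (f x) (f y) = \<rho> ^ n * dist x y"
  unfolding cells_def using word_dist by blast

text \<open>The relative positions of two meeting cells of level \<open>n\<close>, in units of \<open>\<rho> ^ n\<close>; \<open>0\<close> accounts for
  equal cells.\<close>

definition neighbour_shifts :: "'a set" where
  "neighbour_shifts = insert 0 {y - x | x y. x \<in> V0 \<and> y \<in> V0}"

lemma meeting_cells_shift:
  assumes "w \<in> words n" "v \<in> words n" "foldr F w ` K \<inter> foldr F v ` K \<noteq> {}"
  shows "\<exists>t\<in>neighbour_shifts. foldr F w 0 - foldr F v 0 = \<rho> ^ n *\<^sub>R t"
proof (cases "w = v")
  case True then show ?thesis unfolding neighbour_shifts_def by auto
next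
  case False
  obtain x y where xy: "x \<in> K" "y \<in> K" "foldr F w x = foldr F v y"
    using assms(3) by blast
  then have "x \<in> V0" "y \<in> V0"
    using meeting_point_in_V0[OF assms(1,2) False] meeting_point_in_V0[OF assms(2,1)] False by metis+
  moreover have "foldr F w 0 - foldr F v 0 = \<rho> ^ n *\<^sub>R (y - x)"
    using xy(3) word_eq[OF assms(1), of x] word_eq[OF assms(2), of y]
    by (simp add: algebra_simps)
  ultimately show ?thesis unfolding neighbour_shifts_def by blast
qed

end

locale pcf_ifs = homothetic_ifs +
  assumes pcf_K: "pcf N F K"
begin

lemma finite_neighbour_shifts: "finite neighbour_shifts"
proof -
  have "neighbour_shifts = insert 0 ((\<lambda>(x, y). y - x) ` (V0 \<times> V0))"
    unfolding neighbour_shifts_def by auto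
  then show ?thesis using pcf_K unfolding pcf_def by simp
qed

text \<open>Up to a similarity, a pair of children of two meeting cells is one of finitely many pairs of
  compact sets, so that disjoint pairs have a common relative distance.\<close>

lemma disjoint_children_gap:
  obtains c where "c > 0"
    and "\<And>k w v i j x y. \<lbrakk>w \<in> words k; v \<in> words k; i \<in> {1..N}; j \<in> {1..N};
     foldr F w ` K \<inter> foldr F v ` K \<noteq> {}; foldr F (w @ [i]) ` K \<inter> foldr F (v @ [j]) ` K = {};
     x \<in> K; y \<in> K\<rbrakk> \<Longrightarrow> c * \<rho> ^ k \<le> dist (foldr F (w @ [i]) x) (foldr F (v @ [j]) y)"
proof -
  let ?S = "neighbour_shifts \<times> {1..N} \<times> {1..N}"
  let ?far = "\<lambda>c (t, i, j). (\<forall>x\<in>K. \<forall>y\<in>K. F i x + t \<noteq> F j y) \<longrightarrow>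
    (\<forall>x\<in>K. \<forall>y\<in>K. c \<le> dist (F i x + t) (F j y))"
  have "\<exists>c>0. ?far c p" if "p \<in> ?S" for p
  proof -
    obtain t i j where p: "p = (t, i, j)" by (cases p)
    then have ij: "i \<in> {1..N}" "j \<in> {1..N}" using that by simp_all
    show ?thesis
    proof (cases "\<forall>x\<in>K. \<forall>y\<in>K. F i x + t \<noteq> F j y")
      case True
      have "compact ((\<lambda>x. F i x + t) ` K)"
        by (intro compact_continuous_image[OF _ K_compact]
            continuous_on_add[OF F_continuous[OF ij(1)] continuous_on_const])
      moreover have "closed (F j ` K)"
        by (rule compact_imp_closed[OF compact_continuous_image[OF F_continuous[OF ij(2)] K_compact]])
      moreover have "(\<lambda>x. F i x + t) ` K \<inter> F j ` K = {}"
        unfolding disjoint_iff image_iff using True by metis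
      ultimately obtain d where "d > 0" "\<forall>x\<in>(\<lambda>x. F i x + t) ` K. \<forall>y\<in>F j ` K. d \<le> dist x y"
        using separate_compact_closed[of "(\<lambda>x. F i x + t) ` K" "F j ` K"] by metis
      then have "d > 0" "?far d p" unfolding p by simp_all
      then show ?thesis by (intro exI[of _ d] conjI)
    next
      case False
      then have "?far 1 p" unfolding p prod.case by (intro impI) (erule (1) notE)
      with zero_less_one have "(0::real) < 1" "?far 1 p" .
      then show ?thesis by (intro exI[of _ 1] conjI)
    qed
  qed
  then have "\<forall>p\<in>?S. \<exists>c>0. ?far c p" ..
  from bchoice[OF this] obtain c' where c': "\<forall>p\<in>?S. c' p > 0 \<and> ?far (c' p) p" ..
  define c where "c = Min (insert 1 (c' ` ?S))"
  have fin: "finite (insert 1 (c' ` ?S))" using finite_neighbour_shifts by simp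
  have "c > 0" unfolding c_def using fin c' by (subst Min_gr_iff) auto
  have c_le: "c \<le> c' p" if "p \<in> ?S" for p
    unfolding c_def using fin that by (intro Min_le) blast+
  have gap: "c * \<rho> ^ k \<le> dist (foldr F (w @ [i]) x) (foldr F (v @ [j]) y)"
    if w: "w \<in> words k" "v \<in> words k" and ij: "i \<in> {1..N}" "j \<in> {1..N}"
      and meet: "foldr F w ` K \<inter> foldr F v ` K \<noteq> {}"
      and disj: "foldr F (w @ [i]) ` K \<inter> foldr F (v @ [j]) ` K = {}"
      and xy: "x \<in> K" "y \<in> K" for k w v i j x y
  proof -
    obtain t where t: "t \<in> neighbour_shifts" "foldr F w 0 - foldr F v 0 = \<rho> ^ k *\<^sub>R t"
      using meeting_cells_shift[OF w meet] by blast
    have diff: "foldr F (w @ [i]) x - foldr F (v @ [j]) y = \<rho> ^ k *\<^sub>R (F i x + t - F j y)" for x y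
    proof -
      have "foldr F (w @ [i]) x - foldr F (v @ [j]) y
          = (\<rho> ^ k *\<^sub>R F i x + foldr F w 0) - (\<rho> ^ k *\<^sub>R F j y + foldr F v 0)"
        using word_eq[OF w(1), of "F i x"] word_eq[OF w(2), of "F j y"] by simp
      also have "\<dots> = \<rho> ^ k *\<^sub>R F i x + (foldr F w 0 - foldr F v 0) - \<rho> ^ k *\<^sub>R F j y" by simp
      finally show ?thesis unfolding t(2) by (simp add: algebra_simps)
    qed
    have "(t, i, j) \<in> ?S" using t ij by simp
    moreover have "F i x + t \<noteq> F j y" if "x \<in> K" "y \<in> K" for x y
    proof
      assume "F i x + t = F j y"
      then have "foldr F (w @ [i]) x = foldr F (v @ [j]) y" using diff[of x y] by simp
      then show False using disj that by (metis IntI emptyE image_eqI)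
    qed
    ultimately have "c' (t, i, j) \<le> dist (F i x + t) (F j y)"
      using bspec[OF c', of "(t, i, j)"] xy by simp
    then have "c \<le> norm (F i x + t - F j y)"
      using c_le[OF \<open>(t, i, j) \<in> ?S\<close>] by (simp add: dist_norm)
    then show ?thesis
      unfolding dist_norm diff using rho_pos by (simp add: mult.commute mult_left_mono)
  qed
  show thesis by (rule that[OF \<open>c > 0\<close> gap])
qed

text \<open>At the first level where two ancestors are disjoint, they are at a distance comparable with
  their size; all their descendants keep this distance.\<close>

lemma ancestors_of_near_cells_meet:
  assumes "0 \<le> r"
  obtains m where "\<And>n w v x y k. \<lbrakk>w \<in> words n; v \<in> words n; x \<in> K; y \<in> K;
     dist (foldr F w x) (foldr F v y) \<le> r * \<rho> ^ n; k + m \<le> n\<rbrakk> \<Longrightarrow>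
     foldr F (take k w) ` K \<inter> foldr F (take k v) ` K \<noteq> {}"
proof -
  obtain c where "c > 0" and gap: "\<And>k w v i j x y. \<lbrakk>w \<in> words k; v \<in> words k; i \<in> {1..N}; j \<in> {1..N};
     foldr F w ` K \<inter> foldr F v ` K \<noteq> {}; foldr F (w @ [i]) ` K \<inter> foldr F (v @ [j]) ` K = {};
     x \<in> K; y \<in> K\<rbrakk> \<Longrightarrow> c * \<rho> ^ k \<le> dist (foldr F (w @ [i]) x) (foldr F (v @ [j]) y)"
    by (rule disjoint_children_gap, rule that)
  have "(\<lambda>m. r * \<rho> ^ m) \<longlonglongrightarrow> 0"
    using rho_pos rho_less_1 by (intro tendsto_mult_right_zero LIMSEQ_power_zero) simp
  then obtain m where m: "r * \<rho> ^ m < c"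
    using \<open>c > 0\<close> by (metis (no_types, lifting) eventually_sequentially order_tendstoD(2) order_refl)
  have meet: "foldr F (take k w) ` K \<inter> foldr F (take k v) ` K \<noteq> {}"
    if w: "w \<in> words n" and v: "v \<in> words n" and xy: "x \<in> K" "y \<in> K"
      and near: "dist (foldr F w x) (foldr F v y) \<le> r * \<rho> ^ n" and "k + m \<le> n" for n w v x y k
    using \<open>k + m \<le> n\<close>
  proof (induction k)
    case 0 then show ?case using K_nonempty by simp
  next
    case (Suc k)
    show ?case
    proof
      assume disj: "foldr F (take (Suc k) w) ` K \<inter> foldr F (take (Suc k) v) ` K = {}"
      have "k < n" using Suc.prems by simp
      then have split: "take (Suc k) w = take k w @ [w ! k]" "take (Suc k) v = take k v @ [v ! k]"
        and "w ! k \<in> set w" "v ! k \<in> set v"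
        using w v by (auto simp: words_def take_Suc_conv_app_nth)
      then have letters: "w ! k \<in> {1..N}" "v ! k \<in> {1..N}"
        using w v unfolding words_def by blast+
      let ?x = "foldr F (drop (Suc k) w) x" and ?y = "foldr F (drop (Suc k) v) y"
      have "?x \<in> K" "?y \<in> K"
        by (rule word_in_K[OF drop_words[OF w] xy(1)], rule word_in_K[OF drop_words[OF v] xy(2)])
      moreover have "take k w \<in> words k" "take k v \<in> words k"
        using take_words[OF w] take_words[OF v] \<open>k < n\<close> by simp_all
      moreover have "foldr F (take k w) ` K \<inter> foldr F (take k v) ` K \<noteq> {}"
        using Suc by simp
      ultimately have "c * \<rho> ^ k \<le> dist (foldr F (take (Suc k) w) ?x) (foldr F (take (Suc k) v) ?y)"
        using disj letters unfolding split by (intro gap)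
      also have "\<dots> = dist (foldr F w x) (foldr F v y)"
        unfolding foldr_append[symmetric] append_take_drop_id ..
      also have "\<dots> \<le> r * \<rho> ^ (k + m)"
      proof -
        have "\<rho> ^ n \<le> \<rho> ^ (k + m)"
          using Suc.prems rho_pos rho_less_1 by (intro power_decreasing) simp_all
        then show ?thesis by (rule order_trans[OF near mult_left_mono[OF _ assms]])
      qed
      also have "\<dots> = (r * \<rho> ^ m) * \<rho> ^ k" by (simp add: power_add)
      also have "\<dots> < c * \<rho> ^ k" using m rho_pos by simp
      finally show False by simp
    qed
  qed
  show thesis by (rule that[OF meet])
qed

text \<open>All cells that meet \<open>W\<close> are near a fixed one of them. Their ancestors a constant number \<open>m\<close> of levels
  above meet its ancestor and are determined by their relative position to it.\<close>

theorem bounded_overlap: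
  assumes "0 \<le> r"
  obtains C where "\<And>n W. \<lbrakk>bounded W; diameter W \<le> r * \<rho> ^ n\<rbrakk> \<Longrightarrow>
    card {f \<in> cells n. f ` K \<inter> W \<noteq> {}} \<le> C"
proof -
  obtain m where m: "\<And>n w v x y k. \<lbrakk>w \<in> words n; v \<in> words n; x \<in> K; y \<in> K;
     dist (foldr F w x) (foldr F v y) \<le> r * \<rho> ^ n; k + m \<le> n\<rbrakk> \<Longrightarrow>
     foldr F (take k w) ` K \<inter> foldr F (take k v) ` K \<noteq> {}"
    by (rule ancestors_of_near_cells_meet[OF assms], rule that)
  let ?C = "card neighbour_shifts * N ^ m"
  have le_C: "card {f \<in> cells n. f ` K \<inter> W \<noteq> {}} \<le> ?C"
    if W: "bounded W" "diameter W \<le> r * \<rho> ^ n" for n W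
  proof (cases "{f \<in> cells n. f ` K \<inter> W \<noteq> {}} = {}")
    case False
    then obtain f where "f \<in> cells n" "f ` K \<inter> W \<noteq> {}" by auto
    then obtain w x where w: "w \<in> words n" "x \<in> K" "foldr F w x \<in> W"
      unfolding cells_def by auto
    define k where "k = n - m"
    let ?g = "foldr F (take k w)"
    let ?A = "{f \<in> cells k. f ` K \<inter> ?g ` K \<noteq> {}}"
    have kw: "take k w \<in> words k" using take_words[OF w(1)] by (simp add: k_def)
    have split: "f \<in> (\<lambda>(f, h). f \<circ> h) ` (?A \<times> cells (n - k))"
      if f: "f \<in> cells n" "f ` K \<inter> W \<noteq> {}" for f
    proof -
      obtain v y where v: "v \<in> words n" "y \<in> K" "foldr F v y \<in> W" "f = foldr F v"
        using f unfolding cells_def by auto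
      have "dist (foldr F v y) (foldr F w x) \<le> r * \<rho> ^ n"
        using diameter_bounded_bound[OF W(1) v(3) w(3)] W(2) by linarith
      then have "foldr F (take k v) ` K \<inter> ?g ` K \<noteq> {}"
        \<comment> \<open>when \<open>n < m\<close>, the truncated \<open>k\<close> is \<open>0\<close> and both ancestors are \<open>K\<close>\<close>
        using m[OF v(1) w(1) v(2) w(2), of k] K_nonempty by (cases "m \<le> n") (simp_all add: k_def)
      moreover have "foldr F (take k v) \<in> cells k" "foldr F (drop k v) \<in> cells (n - k)"
        unfolding cells_def using take_words[OF v(1), of k] drop_words[OF v(1), of k]
        by (auto simp: k_def)
      moreover have "f = foldr F (take k v) \<circ> foldr F (drop k v)"
        unfolding v(4) using foldr_append[of F "take k v" "drop k v"] by (simp add: fun_eq_iff)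
      ultimately show ?thesis
        by (intro image_eqI[of _ _ "(foldr F (take k v), foldr F (drop k v))"]) simp_all
    qed
    have "{f \<in> cells n. f ` K \<inter> W \<noteq> {}} \<subseteq> (\<lambda>(f, h). f \<circ> h) ` (?A \<times> cells (n - k))"
      using split by (intro subsetI) simp
    then have "card {f \<in> cells n. f ` K \<inter> W \<noteq> {}} \<le> card ((\<lambda>(f, h). f \<circ> h) ` (?A \<times> cells (n - k)))"
      by (intro card_mono finite_imageI finite_cartesian_product) (simp_all add: finite_cells)
    also have "\<dots> \<le> card (?A \<times> cells (n - k))"
      by (intro card_image_le finite_cartesian_product) (simp_all add: finite_cells)
    also have "\<dots> = card ?A * card (cells (n - k))"
      by (rule card_cartesian_product)
    also have "card ?A \<le> card neighbour_shifts"
    proof (rule card_inj_on_le[OF _ _ finite_neighbour_shifts])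
      let ?s = "\<lambda>f. (1 / \<rho> ^ k) *\<^sub>R (f 0 - ?g 0)"
      show "inj_on ?s ?A"
      proof (rule inj_onI)
        fix f h assume "f \<in> ?A" "h \<in> ?A" "?s f = ?s h"
        then have fh: "f \<in> cells k" "h \<in> cells k" "f 0 = h 0" using rho_pos by simp_all
        show "f = h"
        proof
          fix x show "f x = h x" using cell_eq[OF fh(1), of x] cell_eq[OF fh(2), of x] fh(3) by simp
        qed
      qed
      show "?s ` ?A \<subseteq> neighbour_shifts"
      proof (intro subsetI, elim imageE, clarify)
        fix f assume "f \<in> cells k" and meet: "f ` K \<inter> ?g ` K \<noteq> {}"
        then obtain v where v: "v \<in> words k" "f = foldr F v" unfolding cells_def by auto
        show "?s f \<in> neighbour_shifts"
          using meeting_cells_shift[OF v(1) kw] meet rho_pos unfolding v(2) by auto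
      qed
    qed
    also have "card (cells (n - k)) \<le> N ^ m"
      using card_cells[of "n - k"] N_pos power_increasing[of "n - k" m N]
      unfolding k_def by linarith
    finally show ?thesis by simp
  next
    case True
    then show ?thesis by (simp only: card.empty)
  qed
  show thesis by (rule that[OF le_C])
qed

end

section \<open>Covering numbers and the two dimensions\<close>

lemma diameter_le_bound:
  fixes S :: "'a::metric_space set"
  assumes "0 \<le> d" "\<And>x y. x \<in> S \<Longrightarrow> y \<in> S \<Longrightarrow> dist x y \<le> d"
  shows "diameter S \<le> d"
  using assms by (auto simp: diameter_def intro!: cSUP_least)

lemma lipschitz_image_diameter:
  fixes f :: "'a::metric_space \<Rightarrow> 'b::metric_space"
  assumes "0 \<le> r" "\<And>x y. dist (f x) (f y) \<le> r * dist x y" "bounded U"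
  shows "bounded (f ` U)" "diameter (f ` U) \<le> r * diameter U"
proof -
  have le: "dist (f x) (f y) \<le> r * diameter U" if "x \<in> U" "y \<in> U" for x y
    using assms(2)[of x y] mult_left_mono[OF diameter_bounded_bound[OF assms(3) that] assms(1)]
    by linarith
  show "diameter (f ` U) \<le> r * diameter U"
    using assms(1) diameter_ge_0[OF assms(3)] le by (intro diameter_le_bound) auto
  show "bounded (f ` U)"
    unfolding bounded_two_points using le by auto
qed

lemma covering_number_le:
  assumes "finite \<U>" "E \<subseteq> \<Union>\<U>" "\<And>U. U \<in> \<U> \<Longrightarrow> bounded U \<and> diameter U \<le> \<delta>"
  shows "covering_number E \<delta> \<le> card \<U>"
  unfolding covering_number_def using assms by (intro cInf_lower imageI) auto

lemma covering_number_attained: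
  fixes E :: "'a::metric_space set"
  assumes "compact E" "0 < \<delta>"
  obtains \<U> where "finite \<U>" "E \<subseteq> \<Union>\<U>" "\<And>U. U \<in> \<U> \<Longrightarrow> bounded U \<and> diameter U \<le> \<delta>"
    "card \<U> = covering_number E \<delta>"
proof -
  let ?S = "{\<U>. finite \<U> \<and> E \<subseteq> \<Union>\<U> \<and> (\<forall>U\<in>\<U>. bounded U \<and> diameter U \<le> \<delta>)}"
  obtain k where k: "finite k" "E \<subseteq> (\<Union>x\<in>k. ball x (\<delta> / 2))"
    using assms(1)[unfolded compact_eq_totally_bounded] half_gt_zero[OF assms(2)] by meson
  have "diameter (ball x (\<delta> / 2)) \<le> \<delta>" for x :: 'a
  proof (rule diameter_le_bound)
    fix y z assume "y \<in> ball x (\<delta> / 2)" "z \<in> ball x (\<delta> / 2)"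
    then show "dist y z \<le> \<delta>"
      using dist_triangle3[of y z x] by simp
  qed (use assms(2) in simp)
  then have "(\<lambda>x. ball x (\<delta> / 2)) ` k \<in> ?S"
    using k by auto
  then have "covering_number E \<delta> \<in> card ` ?S"
    unfolding covering_number_def by (intro Inf_nat_def1) auto
  then show thesis using that by auto
qed

lemma covering_number_antimono:
  fixes E :: "'a::metric_space set"
  assumes "compact E" "0 < \<delta>" "\<delta> \<le> \<delta>'"
  shows "covering_number E \<delta>' \<le> covering_number E \<delta>"
proof -
  obtain \<U> where \<U>: "finite \<U>" "E \<subseteq> \<Union>\<U>" "\<And>U. U \<in> \<U> \<Longrightarrow> bounded U \<and> diameter U \<le> \<delta>"
    "card \<U> = covering_number E \<delta>"
    using covering_number_attained[OF assms(1,2)] by metis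
  have "covering_number E \<delta>' \<le> card \<U>"
    by (rule covering_number_le[OF \<U>(1,2)]) (use \<U>(3) assms(3) in force)
  then show ?thesis using \<U>(4) by simp
qed

lemma covering_number_lipschitz_union:
  fixes E :: "'a::metric_space set" and A :: "'i \<Rightarrow> 'a set"
  assumes "finite M" "E \<subseteq> (\<Union>p\<in>M. f p ` A p)" "0 < \<delta>"
    and "\<And>p. p \<in> M \<Longrightarrow> compact (A p) \<and> 0 < r p"
    and lip: "\<And>p x y. p \<in> M \<Longrightarrow> dist (f p x) (f p y) \<le> r p * dist x y"
  shows "covering_number E \<delta> \<le> (\<Sum>p\<in>M. covering_number (A p) (\<delta> / r p))"
proof -
  have "\<forall>p\<in>M. \<exists>\<U>. finite \<U> \<and> A p \<subseteq> \<Union>\<U> \<and> (\<forall>U\<in>\<U>. bounded U \<and> diameter U \<le> \<delta> / r p)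
      \<and> card \<U> = covering_number (A p) (\<delta> / r p)"
  proof
    fix p assume "p \<in> M"
    then have "compact (A p)" "0 < \<delta> / r p" using assms by auto
    from covering_number_attained[OF this]
    show "\<exists>\<U>. finite \<U> \<and> A p \<subseteq> \<Union>\<U> \<and> (\<forall>U\<in>\<U>. bounded U \<and> diameter U \<le> \<delta> / r p)
      \<and> card \<U> = covering_number (A p) (\<delta> / r p)" by metis
  qed
  from bchoice[OF this] obtain \<U> where "\<forall>p\<in>M. finite (\<U> p) \<and> A p \<subseteq> \<Union>(\<U> p) \<and>
      (\<forall>U\<in>\<U> p. bounded U \<and> diameter U \<le> \<delta> / r p) \<and> card (\<U> p) = covering_number (A p) (\<delta> / r p)"
    ..
  note \<U> = bspec[OF this]
  let ?V = "\<Union>p\<in>M. (`) (f p) ` \<U> p"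
  have "covering_number E \<delta> \<le> card ?V"
  proof (rule covering_number_le)
    show "finite ?V" using assms(1) \<U> by simp
    show "E \<subseteq> \<Union>?V"
    proof
      fix x assume "x \<in> E"
      then obtain p a where "p \<in> M" "a \<in> A p" "x = f p a" using assms(2) by auto
      moreover from this obtain U where "U \<in> \<U> p" "a \<in> U" using \<U>[of p] by auto
      ultimately show "x \<in> \<Union>?V" by auto
    qed
    fix U' assume "U' \<in> ?V"
    then obtain p U where p: "p \<in> M" "U \<in> \<U> p" "U' = f p ` U" by auto
    have "0 < r p" "bounded U" "diameter U \<le> \<delta> / r p" using \<U>[OF p(1)] p(2) assms(4)[OF p(1)] by auto
    moreover from this have "r p * diameter U \<le> \<delta>" by (simp add: field_simps)
    ultimately show "bounded U' \<and> diameter U' \<le> \<delta>"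
      using lipschitz_image_diameter[of "r p" "f p" U] lip[OF p(1)] unfolding p(3) by fastforce
  qed
  also have "card ?V \<le> (\<Sum>p\<in>M. card ((`) (f p) ` \<U> p))"
    by (rule card_UN_le[OF assms(1)])
  also have "\<dots> \<le> (\<Sum>p\<in>M. covering_number (A p) (\<delta> / r p))"
  proof (rule sum_mono)
    fix p assume "p \<in> M"
    then show "card ((`) (f p) ` \<U> p) \<le> covering_number (A p) (\<delta> / r p)"
      using card_image_le[of "\<U> p" "(`) (f p)"] \<U> by simp
  qed
  finally show ?thesis .
qed

lemma hausdorff_null_iff:
  fixes E :: "'a::metric_space set"
  shows "hausdorff_measure s E = 0 \<longleftrightarrow> (\<forall>\<delta>>0. \<forall>\<epsilon>>0. \<exists>U :: nat \<Rightarrow> 'a set. E \<subseteq> (\<Union>k. U k) \<and>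
     (\<forall>k. bounded (U k) \<and> diameter (U k) \<le> \<delta>) \<and> (\<Sum>k. diam_pow s (U k)) \<le> ennreal \<epsilon>)"
    (is "_ \<longleftrightarrow> ?R")
proof -
  let ?S = "\<lambda>\<delta>. {U :: nat \<Rightarrow> 'a set. E \<subseteq> (\<Union>k. U k) \<and> (\<forall>k. bounded (U k) \<and> diameter (U k) \<le> \<delta>)}"
  have "hausdorff_measure s E = 0 \<longleftrightarrow> (\<forall>\<delta>>0. hausdorff_premeasure s \<delta> E = 0)"
    unfolding hausdorff_measure_def by (auto simp: SUP_eq_iff bot_ennreal[symmetric])
  moreover have "hausdorff_premeasure s \<delta> E = 0 \<longleftrightarrow>
    (\<forall>\<epsilon>>0. \<exists>U\<in>?S \<delta>. (\<Sum>k. diam_pow s (U k)) \<le> ennreal \<epsilon>)" for \<delta>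
  proof
    assume 0: "hausdorff_premeasure s \<delta> E = 0"
    show "\<forall>\<epsilon>>0. \<exists>U\<in>?S \<delta>. (\<Sum>k. diam_pow s (U k)) \<le> ennreal \<epsilon>"
    proof (intro allI impI)
      fix \<epsilon> :: real assume "\<epsilon> > 0"
      then have "hausdorff_premeasure s \<delta> E < ennreal \<epsilon>" using 0 by simp
      then obtain U where "U \<in> ?S \<delta>" "(\<Sum>k. diam_pow s (U k)) < ennreal \<epsilon>"
        unfolding hausdorff_premeasure_def INF_less_iff ..
      then show "\<exists>U\<in>?S \<delta>. (\<Sum>k. diam_pow s (U k)) \<le> ennreal \<epsilon>"
        using less_imp_le by (intro bexI[of _ U])
    qed
  next
    assume R: "\<forall>\<epsilon>>0. \<exists>U\<in>?S \<delta>. (\<Sum>k. diam_pow s (U k)) \<le> ennreal \<epsilon>"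
    have "hausdorff_premeasure s \<delta> E \<le> 0 + ennreal \<epsilon>" if e: "\<epsilon> > 0" for \<epsilon>
    proof -
      obtain U where "U \<in> ?S \<delta>" "(\<Sum>k. diam_pow s (U k)) \<le> ennreal \<epsilon>"
        using R[THEN spec, THEN mp, OF e] ..
      then show ?thesis
        unfolding hausdorff_premeasure_def add_0 by (intro INF_lower2[of U])
    qed
    then have "hausdorff_premeasure s \<delta> E \<le> 0" by (rule ennreal_le_epsilon)
    then show "hausdorff_premeasure s \<delta> E = 0" by simp
  qed
  ultimately show ?thesis by simp
qed

lemma hausdorff_measure_0_pos:
  assumes "hausdorff_measure 0 E = 0" shows "E = {}"
proof -
  obtain U where U: "E \<subseteq> (\<Union>k. U k)" "(\<Sum>k. diam_pow 0 (U k)) \<le> ennreal (1 / 2)"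
    using assms unfolding hausdorff_null_iff by (meson half_gt_zero zero_less_one)
  have "U k = {}" for k
  proof (rule ccontr)
    assume "U k \<noteq> {}"
    then have "1 = sum (\<lambda>k. diam_pow 0 (U k)) {k}" by (simp add: diam_pow_def)
    also have "\<dots> \<le> (\<Sum>k. diam_pow 0 (U k))" by (rule sum_le_suminf) auto
    finally have "1 \<le> ennreal (1 / 2)" using U(2) by (rule order_trans)
    then have "ennreal 1 \<le> ennreal (1 / 2)" by (simp only: ennreal_1)
    then show False by (subst (asm) ennreal_le_iff) simp_all
  qed
  then show ?thesis using U(1) by simp
qed

lemma hausdorff_null_similar:
  fixes f :: "'a::metric_space \<Rightarrow> 'a"
  assumes "0 \<le> s" "f ` A \<subseteq> B" "0 < r" "\<And>x y. dist (f x) (f y) = r * dist x y" "hausdorff_measure s B = 0"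
  shows "hausdorff_measure s A = 0"
  unfolding hausdorff_null_iff
proof (intro allI impI)
  fix \<delta> \<epsilon> :: real assume "0 < \<delta>" "0 < \<epsilon>"
  then have "0 < r * \<delta>" "0 < \<epsilon> * r powr s" using assms(3) by simp_all
  then obtain U where U: "B \<subseteq> (\<Union>k. U k)" "\<And>k. bounded (U k) \<and> diameter (U k) \<le> r * \<delta>"
    "(\<Sum>k. diam_pow s (U k)) \<le> ennreal (\<epsilon> * r powr s)"
    using assms(5) unfolding hausdorff_null_iff by meson
  let ?V = "\<lambda>k. f -` U k"
  have dist: "dist x y \<le> diameter (U k) / r" if "x \<in> ?V k" "y \<in> ?V k" for x y k
    using diameter_bounded_bound[of "U k" "f x" "f y"] U(2) that assms(3,4) by (simp add: field_simps)
  have bdd: "bounded (?V k)" for k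
    unfolding bounded_two_points using dist by meson
  have diam: "diameter (?V k) \<le> diameter (U k) / r" for k
    using dist U(2)[of k] assms(3) by (intro diameter_le_bound) (simp_all add: diameter_ge_0)
  have "diam_pow s (?V k) \<le> ennreal (r powr - s) * diam_pow s (U k)" for k
  proof (cases "?V k = {}")
    case False
    then have ne: "U k \<noteq> {}" by auto
    show ?thesis
    proof (cases "s = 0")
      case True then show ?thesis using assms(3) ne by (simp add: diam_pow_def)
    next
      case s: False
      show ?thesis
      proof -
        have "diameter (?V k) powr s \<le> (diameter (U k) / r) powr s"
          using diam bdd assms(1) by (intro powr_mono2) (simp_all add: diameter_ge_0)
        also have "\<dots> = r powr - s * diameter (U k) powr s"
          using assms(3) U(2)[of k] by (simp add: powr_divide diameter_ge_0 powr_minus field_simps)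
        finally show ?thesis
          using s ne False by (simp add: diam_pow_def ennreal_mult[symmetric] ennreal_leI)
      qed
    qed
  qed (simp add: diam_pow_def)
  then have "(\<Sum>k. diam_pow s (?V k)) \<le> (\<Sum>k. ennreal (r powr - s) * diam_pow s (U k))"
    by (intro suminf_le) auto
  also have "\<dots> = ennreal (r powr - s) * (\<Sum>k. diam_pow s (U k))"
    by (rule ennreal_suminf_cmult)
  also have "\<dots> \<le> ennreal (r powr - s) * ennreal (\<epsilon> * r powr s)"
    using U(3) by (rule mult_left_mono) simp
  also have "\<dots> = ennreal (r powr - s * (\<epsilon> * r powr s))"
    by (rule ennreal_mult[symmetric]) (use \<open>0 < \<epsilon>\<close> in simp_all)
  also have "r powr - s * (\<epsilon> * r powr s) = \<epsilon>"
    using assms(3) by (simp add: powr_minus)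
  finally have sum: "(\<Sum>k. diam_pow s (?V k)) \<le> ennreal \<epsilon>" .
  have "A \<subseteq> f -` B" using assms(2) by auto
  then have "A \<subseteq> (\<Union>k. ?V k)" using vimage_mono[OF U(1), of f] by (simp add: vimage_UN)
  moreover have "bounded (?V k) \<and> diameter (?V k) \<le> \<delta>" for k
  proof -
    have "diameter (U k) / r \<le> \<delta>" using U(2)[of k] assms(3) by (simp add: field_simps)
    then show ?thesis using bdd diam[of k] by simp
  qed
  ultimately show "\<exists>V. A \<subseteq> (\<Union>k. V k) \<and> (\<forall>k. bounded (V k) \<and> diameter (V k) \<le> \<delta>) \<and>
    (\<Sum>k. diam_pow s (V k)) \<le> ennreal \<epsilon>"
    using sum by (intro exI[of _ ?V]) simp
qed

lemma premeasure_le_covering: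
  assumes "0 < t" "finite \<U>" "E \<subseteq> \<Union>\<U>" "\<And>U. U \<in> \<U> \<Longrightarrow> bounded U \<and> diameter U \<le> \<delta>" "0 < \<delta>"
  shows "\<exists>U :: nat \<Rightarrow> 'a::metric_space set. E \<subseteq> (\<Union>k. U k) \<and> (\<forall>k. bounded (U k) \<and> diameter (U k) \<le> \<delta>)
     \<and> (\<Sum>k. diam_pow t (U k)) \<le> ennreal (card \<U> * \<delta> powr t)"
proof -
  obtain h where h: "bij_betw h {0..<card \<U>} \<U>"
    using ex_bij_betw_nat_finite[OF assms(2)] ..
  define U where "U k = (if k < card \<U> then h k else {})" for k
  have hU: "h k \<in> \<U>" if "k < card \<U>" for k
    using bij_betwE[OF h] that by simp
  have "E \<subseteq> (\<Union>k. U k)"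
  proof
    fix x assume "x \<in> E"
    then obtain S where "S \<in> \<U>" "x \<in> S" using assms(3) by auto
    moreover from this have "S \<in> h ` {0..<card \<U>}" using bij_betw_imp_surj_on[OF h] by simp
    then obtain k where "k < card \<U>" "h k = S" by auto
    ultimately have "x \<in> U k" unfolding U_def by simp
    then show "x \<in> (\<Union>k. U k)" by (rule UN_I[OF UNIV_I])
  qed
  moreover have U: "bounded (U k) \<and> diameter (U k) \<le> \<delta>" for k
    using assms(4)[OF hU] assms(5) unfolding U_def by simp
  moreover have "(\<Sum>k. diam_pow t (U k)) \<le> ennreal (card \<U> * \<delta> powr t)"
  proof -
    have "(\<Sum>k. diam_pow t (U k)) = (\<Sum>k<card \<U>. diam_pow t (U k))"
      by (rule suminf_finite) (auto simp: U_def diam_pow_def)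
    also have "\<dots> \<le> (\<Sum>k<card \<U>. ennreal (\<delta> powr t))"
      using assms(1) U by (intro sum_mono) (auto simp: diam_pow_def diameter_ge_0 intro!: ennreal_leI powr_mono2)
    also have "\<dots> = ennreal (card \<U> * \<delta> powr t)"
      by (simp add: ennreal_mult ennreal_of_nat_eq_real_of_nat)
    finally show ?thesis .
  qed
  ultimately show ?thesis by (intro exI[of _ U] conjI allI) auto
qed

text \<open>For \<open>t < t'\<close> above the lower box dimension, there are arbitrarily small \<open>\<delta>\<close> with an optimal cover of
  at most \<open>\<delta> powr - t\<close> sets, and these contribute at most \<open>\<delta> powr (t' - t)\<close> to the \<open>t'\<close>-dimensional
  measure.\<close>

lemma hausdorff_dim_le_lower_box_dim:
  fixes E :: "'a::metric_space set"
  assumes "compact E"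
  shows "hausdorff_dim E \<le> lower_box_dim E"
proof (rule dense_ge)
  fix y assume y: "lower_box_dim E < y"
  let ?q = "\<lambda>\<delta>. ln (real (covering_number E \<delta>)) / - ln \<delta>"
  have small: "\<forall>\<^sub>F \<delta> in at_right (0::real). 0 < \<delta> \<and> \<delta> < d" if "0 < d" for d
    using that unfolding eventually_at_right_field by auto
  have ln_nat: "0 \<le> ln (real n)" for n by (cases n) auto
  have "0 \<le> lower_box_dim E"
    unfolding lower_box_dim_def
  proof (rule Liminf_bounded)
    show "\<forall>\<^sub>F \<delta> in at_right 0. 0 \<le> ereal (?q \<delta>)"
      using small[OF zero_less_one]
    proof eventually_elim
      case (elim \<delta>)
      then have "0 < - ln \<delta>" by simp
      then show ?case unfolding ereal_less_eq zero_ereal_def using ln_nat by (intro divide_nonneg_pos)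
    qed
  qed
  moreover obtain t' where t': "lower_box_dim E < ereal t'" "ereal t' < y"
    using ereal_dense2[OF y] by auto
  moreover obtain t where t: "lower_box_dim E < ereal t" "ereal t < ereal t'"
    using ereal_dense2[OF t'(1)] by auto
  ultimately have pos: "0 < t" "t < t'"
    by (metis ereal_less(2) order_le_less_trans, simp)
  have "hausdorff_measure t' E = 0"
    unfolding hausdorff_null_iff
  proof (intro allI impI)
    fix \<delta>0 \<epsilon> :: real assume "0 < \<delta>0" "0 < \<epsilon>"
    have "((\<lambda>\<delta>. \<delta> powr (t' - t)) \<longlongrightarrow> 0) (at_right 0)"
    proof (rule tendsto_zero_powrI[OF tendsto_ident_at tendsto_const])
      show "\<forall>\<^sub>F \<delta> in at_right 0. 0 \<le> (\<delta>::real)"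
        by (rule eventually_mono[OF small[OF zero_less_one]]) simp
    qed (use pos in simp)
    then have "\<forall>\<^sub>F \<delta> in at_right 0. \<delta> powr (t' - t) < \<epsilon>"
      using \<open>0 < \<epsilon>\<close> by (rule order_tendstoD)
    then have ev: "\<forall>\<^sub>F \<delta> in at_right 0. \<delta> powr (t' - t) < \<epsilon> \<and> 0 < \<delta> \<and> \<delta> < min 1 \<delta>0"
      using small[of "min 1 \<delta>0"] \<open>0 < \<delta>0\<close> by (auto intro: eventually_conj)
    have "\<not> (\<forall>\<^sub>F \<delta> in at_right 0. ereal t \<le> ereal (?q \<delta>))"
      using Liminf_bounded[of "ereal t" "\<lambda>\<delta>. ereal (?q \<delta>)" "at_right 0"] t(1)
      unfolding lower_box_dim_def by (auto simp: not_le[symmetric])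
    then have "\<exists>\<^sub>F \<delta> in at_right 0. ?q \<delta> < t"
      unfolding frequently_def by (simp add: not_less)
    then have "\<exists>\<^sub>F \<delta> in at_right 0. (\<delta> powr (t' - t) < \<epsilon> \<and> 0 < \<delta> \<and> \<delta> < min 1 \<delta>0) \<and> ?q \<delta> < t"
      using ev by (rule frequently_eventually_conj)
    then obtain \<delta> where \<delta>: "?q \<delta> < t" "\<delta> powr (t' - t) < \<epsilon>" "0 < \<delta>" "\<delta> < 1" "\<delta> < \<delta>0"
      using frequently_ex by fastforce
    obtain \<U> where \<U>: "finite \<U>" "E \<subseteq> \<Union>\<U>" "\<And>U. U \<in> \<U> \<Longrightarrow> bounded U \<and> diameter U \<le> \<delta>"
      "card \<U> = covering_number E \<delta>"
      by (rule covering_number_attained[OF assms \<open>0 < \<delta>\<close>], rule that)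
    have "real (card \<U>) \<le> \<delta> powr - t"
    proof (cases "card \<U> = 0")
      case False
      have "ln (real (card \<U>)) < t * - ln \<delta>"
        using \<delta>(1,3,4) unfolding \<U>(4) by (subst (asm) pos_divide_less_eq) simp_all
      then have "exp (ln (real (card \<U>))) \<le> exp (t * - ln \<delta>)" by (subst exp_le_cancel_iff) simp
      then show ?thesis using False \<delta>(3) by (simp add: powr_def)
    qed simp
    then have "card \<U> * \<delta> powr t' \<le> \<delta> powr - t * \<delta> powr t'" by (rule mult_right_mono) simp
    also have "\<dots> = \<delta> powr (t' - t)" by (simp flip: powr_add)
    finally have le: "ennreal (card \<U> * \<delta> powr t') \<le> ennreal \<epsilon>" using \<delta>(2) by (intro ennreal_leI) simp
    have "0 < t'" using pos by simp
    from premeasure_le_covering[OF this \<U>(1-3) \<delta>(3)]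
    obtain U where U: "E \<subseteq> (\<Union>k. U k) \<and> (\<forall>k. bounded (U k) \<and> diameter (U k) \<le> \<delta>)
     \<and> (\<Sum>k. diam_pow t' (U k)) \<le> ennreal (card \<U> * \<delta> powr t')" ..
    then have "bounded (U k) \<and> diameter (U k) \<le> \<delta>0" for k
      using \<delta>(5) by (meson less_imp_le order_trans)
    then show "\<exists>U. E \<subseteq> (\<Union>k. U k) \<and> (\<forall>k. bounded (U k) \<and> diameter (U k) \<le> \<delta>0)
      \<and> (\<Sum>k. diam_pow t' (U k)) \<le> ennreal \<epsilon>"
      using U le order_trans[OF _ le] by (intro exI[of _ U]) simp
  qed
  then have "hausdorff_dim E \<le> ereal t'"
    unfolding hausdorff_dim_def using pos by (intro Inf_lower imageI) simp
  then show "hausdorff_dim E \<le> y" using t'(2) by simp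
qed

lemma upper_box_dim_le:
  assumes "\<And>\<delta>. 0 < \<delta> \<Longrightarrow> \<delta> \<le> 1 \<Longrightarrow> real (covering_number E \<delta>) \<le> C * \<delta> powr - s"
    and "0 \<le> s"
  shows "upper_box_dim E \<le> ereal s"
proof -
  (* With a constant of at least 1, the bound below is nonnegative and so holds also where the covering
     number, and with it the value of ln, is 0. *)
  define D where "D = max C 1"
  let ?q = "\<lambda>\<delta>. ln (real (covering_number E \<delta>)) / - ln \<delta>"
  have lim: "((\<lambda>\<delta>. ereal (ln D / - ln \<delta> + s)) \<longlongrightarrow> ereal s) (at_right 0)"
  proof -
    have "filterlim (\<lambda>\<delta>::real. - ln \<delta>) at_top (at_right 0)"
      using ln_at_0 by (simp add: filterlim_uminus_at_top)
    then have "((\<lambda>\<delta>. ln D / - ln \<delta>) \<longlongrightarrow> 0) (at_right 0)"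
      by (intro tendsto_divide_0[OF tendsto_const] filterlim_at_top_imp_at_infinity)
    then have "((\<lambda>\<delta>. ln D / - ln \<delta> + s) \<longlongrightarrow> 0 + s) (at_right 0)"
      by (intro tendsto_intros)
    then show ?thesis by simp
  qed
  have "\<forall>\<^sub>F \<delta> in at_right (0::real). 0 < \<delta> \<and> \<delta> < 1"
    unfolding eventually_at_right_field by (intro exI[of _ 1]) simp
  then have "\<forall>\<^sub>F \<delta> in at_right 0. ereal (?q \<delta>) \<le> ereal (ln D / - ln \<delta> + s)"
  proof eventually_elim
    case (elim \<delta>)
    then have \<delta>: "0 < \<delta>" "\<delta> < 1" "0 < - ln \<delta>" by simp_all
    let ?n = "real (covering_number E \<delta>)"
    have "ln ?n \<le> ln D + s * - ln \<delta>"
    proof (cases "?n = 0")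
      case True
      then show ?thesis using assms(2) \<delta>(3) unfolding D_def
        by (simp add: mult_nonneg_nonneg) (smt (verit) ln_ge_zero mult_nonneg_nonpos)
    next
      case False
      have "?n \<le> C * \<delta> powr - s" using assms(1) \<delta> by simp
      also have "\<dots> \<le> D * \<delta> powr - s" unfolding D_def by (intro mult_right_mono) simp_all
      finally have "ln ?n \<le> ln (D * \<delta> powr - s)"
        using False by (subst ln_le_cancel_iff) (auto simp: D_def \<delta>)
      also have "\<dots> = ln D + s * - ln \<delta>"
        using \<delta> by (subst ln_mult) (auto simp: D_def ln_powr)
      finally show ?thesis .
    qed
    then have "?q \<delta> \<le> (ln D + s * - ln \<delta>) / - ln \<delta>"
      using \<delta>(3) by (intro divide_right_mono) simp_all
    also have "\<dots> = ln D / - ln \<delta> + s" using \<delta>(3) by (subst add_divide_distrib) simp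
    finally show ?case by simp
  qed
  then have "upper_box_dim E \<le> Limsup (at_right 0) (\<lambda>\<delta>. ereal (ln D / - ln \<delta> + s))"
    unfolding upper_box_dim_def by (rule Limsup_mono)
  also have "\<dots> = ereal s" by (rule lim_imp_Limsup[OF _ lim]) simp
  finally show ?thesis .
qed

section \<open>Covering numbers from finite self-covers\<close>

text \<open>Iterating the covers, a set is replaced by smaller copies of sets of the family without any
  increase of the total \<open>s\<close>-th power of the ratios, until the ratios are comparable with \<open>\<delta>\<close>.
  Formally, the claim for \<open>\<delta>\<close> follows from the claim for the larger values \<open>\<delta> / r\<close>.\<close>

lemma covering_number_le_of_self_cover:
  fixes A :: "'i \<Rightarrow> 'a::metric_space set"
  assumes fin: "finite I" and comp: "\<And>j. j \<in> I \<Longrightarrow> compact (A j)"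
    and cover: "\<And>j. j \<in> I \<Longrightarrow> \<exists>M :: (real \<times> ('a \<Rightarrow> 'a) \<times> 'i) set. finite M \<and>
      (\<forall>(r, f, k)\<in>M. 0 < r \<and> r < 1 \<and> k \<in> I \<and> (\<forall>x y. dist (f x) (f y) \<le> r * dist x y)) \<and>
      A j \<subseteq> (\<Union>(r, f, k)\<in>M. f ` A k) \<and> (\<Sum>(r, f, k)\<in>M. r powr s) \<le> 1"
    and s: "0 \<le> s"
  shows "\<exists>C. \<forall>j\<in>I. \<forall>\<delta>. 0 < \<delta> \<longrightarrow> \<delta> \<le> 1 \<longrightarrow> real (covering_number (A j) \<delta>) \<le> C * \<delta> powr - s"
proof -
  let ?P = "\<lambda>j M. finite M \<and>
      (\<forall>(r, f, k)\<in>M. 0 < r \<and> r < 1 \<and> k \<in> I \<and> (\<forall>x y. dist (f x) (f y) \<le> r * dist x y)) \<and>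
      A j \<subseteq> (\<Union>(r, f, k)\<in>M. f ` A k) \<and> (\<Sum>(r, f, k)\<in>M. r powr s) \<le> 1"
  have "\<forall>j\<in>I. \<exists>M. ?P j M" using cover ..
  from bchoice[OF this] obtain M where "\<forall>j\<in>I. ?P j (M j)" ..
  note M = bspec[OF this]
  define rs where "rs = (\<Union>j\<in>I. fst ` M j)"
  have fin_rs: "finite rs" unfolding rs_def using fin M by simp
  have rs: "0 < r \<and> r < 1" if "r \<in> rs" for r
  proof -
    obtain j p where "j \<in> I" "p \<in> M j" "r = fst p" using \<open>r \<in> rs\<close> unfolding rs_def by auto
    then show ?thesis using M[of j] by (cases p) auto
  qed
  define a where "a = Min (insert 1 rs)"
  define q where "q = Max (insert (1 / 2) rs)"
  have a: "0 < a" "\<And>r. r \<in> rs \<Longrightarrow> a \<le> r" "a \<le> 1"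
    unfolding a_def using fin_rs rs by auto
  have q: "0 < q" "q < 1" "\<And>r. r \<in> rs \<Longrightarrow> r \<le> q"
    unfolding q_def using fin_rs rs by (auto simp: less_max_iff_disj Max_gr_iff)
  define C where "C = real (\<Sum>j\<in>I. covering_number (A j) a)"
  have C0: "0 \<le> C" unfolding C_def by (rule of_nat_0_le_iff)
  have large: "real (covering_number (A j) \<delta>) \<le> C * \<delta> powr - s"
    if "j \<in> I" "a \<le> \<delta>" "\<delta> \<le> 1" for j \<delta>
  proof -
    have "covering_number (A j) \<delta> \<le> covering_number (A j) a"
      using covering_number_antimono[OF comp[OF \<open>j \<in> I\<close>] a(1) \<open>a \<le> \<delta>\<close>] .
    also have "\<dots> \<le> (\<Sum>j\<in>I. covering_number (A j) a)"
      using fin \<open>j \<in> I\<close> by (intro member_le_sum) simp_all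
    finally have "real (covering_number (A j) \<delta>) \<le> C" unfolding C_def of_nat_le_iff .
    also have "\<dots> \<le> C * \<delta> powr - s"
    proof -
      have "\<delta> powr s \<le> 1" using that a(1) s by (intro powr_le1) simp_all
      then have "1 \<le> \<delta> powr - s" using that a(1) by (simp add: powr_minus one_le_inverse)
      then show ?thesis using mult_left_mono[OF _ C0] by fastforce
    qed
    finally show ?thesis .
  qed
  have main: "real (covering_number (A j) \<delta>) \<le> C * \<delta> powr - s"
    if "j \<in> I" "q ^ n \<le> \<delta>" "\<delta> \<le> 1" for n j \<delta>
    using that
  proof (induction n arbitrary: j \<delta>)
    case 0
    then show ?case using large[of j \<delta>] a(3) by simp
  next
    case (Suc n)
    show ?case
    proof (cases "a \<le> \<delta>")
      case True then show ?thesis using large Suc.prems by simp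
    next
      case False
      have \<delta>: "0 < \<delta>" using Suc.prems(2) q(1) zero_less_power[OF q(1), of "Suc n"] by linarith
      have Mj: "0 < fst p" "fst p < 1" "fst p \<in> rs" "snd (snd p) \<in> I"
        "\<And>x y. dist (fst (snd p) x) (fst (snd p) y) \<le> fst p * dist x y" if "p \<in> M j" for p
      proof -
        have "\<forall>p\<in>M j. 0 < fst p \<and> fst p < 1 \<and> snd (snd p) \<in> I \<and>
            (\<forall>x y. dist (fst (snd p) x) (fst (snd p) y) \<le> fst p * dist x y)"
          using M[OF Suc.prems(1)] by (simp add: case_prod_beta)
        from bspec[OF this that] show "0 < fst p" "fst p < 1" "snd (snd p) \<in> I"
          "\<And>x y. dist (fst (snd p) x) (fst (snd p) y) \<le> fst p * dist x y" by simp_all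
        show "fst p \<in> rs" unfolding rs_def using Suc.prems(1) that by (intro UN_I imageI)
      qed
      have "covering_number (A j) \<delta> \<le> (\<Sum>p\<in>M j. covering_number (A (snd (snd p))) (\<delta> / fst p))"
      proof (rule covering_number_lipschitz_union)
        show "finite (M j)" using M[OF Suc.prems(1)] by simp
        show "A j \<subseteq> (\<Union>p\<in>M j. fst (snd p) ` A (snd (snd p)))"
          using M[OF Suc.prems(1)] by (simp add: case_prod_beta)
      qed (use \<delta> Mj comp in auto)
      then have "real (covering_number (A j) \<delta>)
          \<le> (\<Sum>p\<in>M j. real (covering_number (A (snd (snd p))) (\<delta> / fst p)))"
        by (simp flip: of_nat_sum)
      also have "\<dots> \<le> (\<Sum>p\<in>M j. C * \<delta> powr - s * fst p powr s)"
      proof (rule sum_mono)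
        fix p assume p: "p \<in> M j"
        have "q ^ n * fst p \<le> q ^ n * q" using q Mj(3)[OF p] by (intro mult_left_mono) simp_all
        then have "q ^ n \<le> \<delta> / fst p"
          using Suc.prems(2) Mj(1)[OF p] by (simp add: pos_le_divide_eq mult.commute)
        moreover have "\<delta> / fst p \<le> 1" using False a(2)[OF Mj(3)[OF p]] Mj(1)[OF p] by simp
        ultimately have "real (covering_number (A (snd (snd p))) (\<delta> / fst p))
          \<le> C * (\<delta> / fst p) powr - s"
          by (rule Suc.IH[OF Mj(4)[OF p]])
        also have "(\<delta> / fst p) powr - s = \<delta> powr - s * fst p powr s"
          using \<delta> Mj(1)[OF p] by (simp add: powr_divide powr_minus field_simps)
        finally show "real (covering_number (A (snd (snd p))) (\<delta> / fst p))
          \<le> C * \<delta> powr - s * fst p powr s" by (simp add: mult.assoc)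
      qed
      also have "\<dots> = C * \<delta> powr - s * (\<Sum>p\<in>M j. fst p powr s)"
        by (simp add: sum_distrib_left)
      also have "\<dots> \<le> C * \<delta> powr - s * 1"
      proof (rule mult_left_mono)
        show "(\<Sum>p\<in>M j. fst p powr s) \<le> 1" using M[OF Suc.prems(1)] by (simp add: case_prod_beta)
      qed (use C0 in simp)
      finally show ?thesis by simp
    qed
  qed
  have "real (covering_number (A j) \<delta>) \<le> C * \<delta> powr - s" if j: "j \<in> I" "0 < \<delta>" "\<delta> \<le> 1" for j \<delta>
  proof -
    obtain n where "q ^ n < \<delta>" using real_arch_pow_inv[OF j(2) q(2)] ..
    then show ?thesis using main[of j n \<delta>] j by simp
  qed
  then show ?thesis by (intro exI[of _ C] ballI allI impI)
qed

text \<open>This selects the level of the cells that replace a covering set of diameter \<open>d\<close>. The slack \<open>\<eta>\<close>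
  serves the case \<open>d = 0\<close>, where no level is comparable with \<open>d\<close>.\<close>

lemma comparable_power_scale:
  fixes \<rho> d s \<eta> :: real
  assumes "0 < \<rho>" "\<rho> < 1" "0 \<le> d" "d \<le> 1" "0 < s" "0 < \<eta>"
  shows "\<exists>n. d \<le> \<rho> ^ n \<and> (\<rho> ^ n) powr s \<le> \<rho> powr - s * d powr s + \<eta>"
proof (cases "d = 0")
  case True
  have "(\<lambda>n. (\<rho> ^ n) powr s) \<longlonglongrightarrow> 0"
  proof (rule tendsto_zero_powrI[OF _ tendsto_const])
    show "(\<lambda>n. \<rho> ^ n) \<longlonglongrightarrow> 0" using assms by (intro LIMSEQ_power_zero) simp
    show "\<forall>\<^sub>F n in sequentially. 0 \<le> \<rho> ^ n" using assms by simp
  qed (rule assms)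
  then have "\<forall>\<^sub>F n in sequentially. (\<rho> ^ n) powr s < \<eta>" using assms(6) by (rule order_tendstoD)
  then obtain n where "(\<rho> ^ n) powr s < \<eta>" unfolding eventually_sequentially by auto
  then show ?thesis using True assms by (intro exI[of _ n]) simp
next
  case False
  then have "0 < d" using assms by simp
  define m where "m = (LEAST n. \<rho> ^ n < d)"
  obtain n where "\<rho> ^ n < d" using real_arch_pow_inv[OF \<open>0 < d\<close> assms(2)] ..
  then have m: "\<rho> ^ m < d" unfolding m_def by (rule LeastI)
  then have "m \<noteq> 0" using assms(4) by (intro notI) simp
  then obtain k where k: "m = Suc k" by (cases m) simp_all
  have "\<not> \<rho> ^ k < d" using not_less_Least[of k "\<lambda>n. \<rho> ^ n < d"] k unfolding m_def by simp
  moreover have "(\<rho> ^ k) powr s \<le> \<rho> powr - s * d powr s"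
  proof -
    have "\<rho> ^ k \<le> d / \<rho>" using m assms(1) unfolding k by (simp add: field_simps)
    then have "(\<rho> ^ k) powr s \<le> (d / \<rho>) powr s" using assms by (intro powr_mono2) simp_all
    then show ?thesis using assms by (simp add: powr_divide powr_minus field_simps)
  qed
  ultimately show ?thesis using assms(6) by (intro exI[of _ k]) simp
qed

section \<open>Dimensions of graph directed families of cells\<close>

context pcf_ifs
begin

lemma level_pieces:
  assumes gds: "\<And>j x. j \<in> I \<Longrightarrow> x \<in> A j \<Longrightarrow>
      \<exists>i\<in>{1..N}. \<exists>k\<in>I. F i ` A k \<subseteq> A j \<and> x \<in> F i ` A k"
    and "j \<in> I" "x \<in> A j"
  shows "\<exists>f\<in>cells n. \<exists>k\<in>I. f ` A k \<subseteq> A j \<and> x \<in> f ` A k"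
  using assms(2,3)
proof (induction n arbitrary: j x)
  case 0
  then show ?case by (intro bexI[of _ id] bexI[of _ j]) simp_all
next
  case (Suc n)
  obtain i k where ik: "i \<in> {1..N}" "k \<in> I" "F i ` A k \<subseteq> A j" "x \<in> F i ` A k"
    using gds[OF Suc.prems] by auto
  then obtain y where y: "y \<in> A k" "x = F i y" by auto
  obtain f l where fl: "f \<in> cells n" "l \<in> I" "f ` A l \<subseteq> A k" "y \<in> f ` A l"
    using Suc.IH[OF ik(2) y(1)] by auto
  have "(F i \<circ> f) ` A l \<subseteq> A j"
    unfolding image_comp[symmetric] by (rule order_trans[OF image_mono[OF fl(3)] ik(3)])
  moreover have "x \<in> (F i \<circ> f) ` A l"
    unfolding image_comp[symmetric] y(2) by (rule imageI[OF fl(4)])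
  ultimately show ?case
    using cells_SucI[OF ik(1) fl(1)] fl(2) by (intro bexI[of _ "F i \<circ> f"] bexI[of _ l] conjI)
qed

text \<open>A cover of \<open>A j\<close> by sets \<open>U k\<close> with small sum of \<open>diameter (U k) powr s\<close> is turned into a
  finite self-cover: \<open>U k\<close> is fattened to an open set of diameter comparable with the size
  \<open>\<rho> ^ n k\<close> of the cells of some level \<open>n k\<close>, and meets a bounded number of these cells. All members \<open>A i\<close>
  that occur are null sets themselves, because \<open>A j\<close> contains a similar copy of them.\<close>

lemma null_set_self_cover:
  assumes fin: "finite I"
    and A: "\<And>j. j \<in> I \<Longrightarrow> compact (A j) \<and> A j \<subseteq> K"
    and gds: "\<And>j x. j \<in> I \<Longrightarrow> x \<in> A j \<Longrightarrow>
      \<exists>i\<in>{1..N}. \<exists>k\<in>I. F i ` A k \<subseteq> A j \<and> x \<in> F i ` A k"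
    and s: "0 < s" and j: "j \<in> I" and null: "hausdorff_measure s (A j) = 0"
  shows "\<exists>M :: (real \<times> ('a \<Rightarrow> 'a) \<times> 'i) set. finite M \<and>
      (\<forall>(r, f, k)\<in>M. 0 < r \<and> r < 1 \<and> k \<in> {k \<in> I. hausdorff_measure s (A k) = 0} \<and>
         (\<forall>x y. dist (f x) (f y) \<le> r * dist x y)) \<and>
      A j \<subseteq> (\<Union>(r, f, k)\<in>M. f ` A k) \<and> (\<Sum>(r, f, k)\<in>M. r powr s) \<le> 1"
proof -
  obtain C where C: "\<And>n W. \<lbrakk>bounded W; diameter W \<le> 3 * \<rho> ^ n\<rbrakk> \<Longrightarrow>
    card {f \<in> cells n. f ` K \<inter> W \<noteq> {}} \<le> C"
    by (rule bounded_overlap[of 3], simp, rule that)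
  (* Each U k is replaced by at most C * card I copies; the summand 2 makes 1 / c less than 1, which
     excludes level 0 below. *)
  define c where "c = real C * real (card I) + 2"
  have c: "2 \<le> c" unfolding c_def by simp
  (* The slacks e / 2 ^ k sum up to at most 2 e, the diameters contribute at most \<rho> powr - s * e. *)
  define e where "e = 1 / (c * (\<rho> powr - s + 2))"
  have e: "0 < e" unfolding e_def using c by (intro divide_pos_pos mult_pos_pos add_nonneg_pos) simp_all
  obtain U where U: "A j \<subseteq> (\<Union>k. U k)" "\<And>k. bounded (U k) \<and> diameter (U k) \<le> 1"
    "(\<Sum>k. diam_pow s (U k)) \<le> ennreal e"
    using null[unfolded hausdorff_null_iff, THEN spec, THEN mp, OF zero_less_one, THEN spec, THEN mp, OF e]
    by auto
  have "\<exists>n. diameter (U k) \<le> \<rho> ^ n \<and> (\<rho> ^ n) powr s \<le> \<rho> powr - s * diameter (U k) powr s + e * (1 / 2) ^ k" for k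
    using U(2)[of k] e s rho_pos rho_less_1 by (intro comparable_power_scale) (simp_all add: diameter_ge_0)
  then have "\<forall>k. \<exists>n. diameter (U k) \<le> \<rho> ^ n \<and>
    (\<rho> ^ n) powr s \<le> \<rho> powr - s * diameter (U k) powr s + e * (1 / 2) ^ k" ..
  from choice[OF this] obtain n where "\<forall>k. diameter (U k) \<le> \<rho> ^ n k \<and>
    (\<rho> ^ n k) powr s \<le> \<rho> powr - s * diameter (U k) powr s + e * (1 / 2) ^ k" ..
  then have n: "diameter (U k) \<le> \<rho> ^ n k"
    "(\<rho> ^ n k) powr s \<le> \<rho> powr - s * diameter (U k) powr s + e * (1 / 2) ^ k" for k by simp_all
  define W where "W k = (\<Union>u\<in>U k. ball u (\<rho> ^ n k))" for k
  have W_dist: "dist x y \<le> 3 * \<rho> ^ n k" if xy: "x \<in> W k" "y \<in> W k" for x y k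
  proof -
    obtain u v where uv: "u \<in> U k" "v \<in> U k" "dist u x < \<rho> ^ n k" "dist v y < \<rho> ^ n k"
      using xy unfolding W_def by auto
    have "dist u v \<le> \<rho> ^ n k" using diameter_bounded_bound[OF _ uv(1,2)] U(2)[of k] n(1)[of k] by simp
    then show ?thesis
      using uv(3,4) dist_triangle[of x y u] dist_triangle[of u y v] by (simp add: dist_commute)
  qed
  have W_bounded: "bounded (W k)" for k
    unfolding bounded_two_points using W_dist by (intro exI ballI)
  have W_diameter: "diameter (W k) \<le> 3 * \<rho> ^ n k" for k
    using W_dist rho_pos by (intro diameter_le_bound) simp_all
  have "U k \<subseteq> W k" for k
  proof
    fix u assume "u \<in> U k"
    then show "u \<in> W k" unfolding W_def using rho_pos by (intro UN_I[of u]) simp_all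
  qed
  then have "A j \<subseteq> (\<Union>k\<in>UNIV. W k)" using U(1) by (meson UN_mono order_refl order_trans)
  moreover have "compact (A j)" using A[OF j] ..
  moreover have "open (W k)" for k unfolding W_def by (intro open_UN ballI open_ball)
  ultimately obtain T where T: "finite T" "A j \<subseteq> (\<Union>k\<in>T. W k)"
    using compactE_image[of "A j" UNIV W] by auto
  have total: "(\<Sum>k\<in>T. (\<rho> ^ n k) powr s) \<le> 1 / c"
  proof -
    have "ennreal (\<Sum>k\<in>T. diameter (U k) powr s) = (\<Sum>k\<in>T. ennreal (diameter (U k) powr s))"
      by (rule sum_ennreal[symmetric]) simp
    also have "\<dots> \<le> (\<Sum>k\<in>T. diam_pow s (U k))"
      using s by (intro sum_mono) (simp add: diam_pow_def)
    also have "\<dots> \<le> (\<Sum>k. diam_pow s (U k))" using T(1) by (intro sum_le_suminf) simp_all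
    also have "\<dots> \<le> ennreal e" by (rule U(3))
    finally have diam: "(\<Sum>k\<in>T. diameter (U k) powr s) \<le> e"
      by (subst (asm) ennreal_le_iff) (use e in simp_all)
    have "(\<Sum>k\<in>T. (1 / 2) ^ k) \<le> (\<Sum>k. (1 / 2 :: real) ^ k)"
      using T(1) by (intro sum_le_suminf summable_geometric) simp_all
    also have "\<dots> = 2" by (subst suminf_geometric) simp_all
    finally have geo: "(\<Sum>k\<in>T. (1 / 2 :: real) ^ k) \<le> 2" .
    have "(\<Sum>k\<in>T. (\<rho> ^ n k) powr s) \<le> (\<Sum>k\<in>T. \<rho> powr - s * diameter (U k) powr s + e * (1 / 2) ^ k)"
      by (intro sum_mono n)
    also have "\<dots> = \<rho> powr - s * (\<Sum>k\<in>T. diameter (U k) powr s) + e * (\<Sum>k\<in>T. (1 / 2) ^ k)"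
      by (simp only: sum.distrib sum_distrib_left)
    also have "\<dots> \<le> \<rho> powr - s * e + e * 2"
      using diam geo e by (intro add_mono mult_left_mono) simp_all
    also have "\<dots> = e * (\<rho> powr - s + 2)" by (simp add: algebra_simps)
    also have "\<dots> = 1 / c"
    proof -
      have "\<rho> powr - s + 2 \<noteq> 0" using powr_ge_zero[of \<rho> "- s"] by linarith
      then show ?thesis unfolding e_def by simp
    qed
    finally show ?thesis .
  qed
  have small: "\<rho> ^ n k < 1" if "k \<in> T" for k
  proof (rule ccontr)
    assume "\<not> \<rho> ^ n k < 1"
    then have "n k = 0" using power_Suc_less_one[of \<rho>] rho_pos rho_less_1 by (cases "n k") auto
    then have "1 \<le> (\<Sum>k\<in>T. (\<rho> ^ n k) powr s)"
      using member_le_sum[of k T "\<lambda>k. (\<rho> ^ n k) powr s"] T(1) that by simp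
    also have "\<dots> \<le> 1 / c" by (rule total)
    also have "\<dots> < 1" using c by simp
    finally show False by simp
  qed
  define S where "S k = {f \<in> cells (n k). f ` K \<inter> W k \<noteq> {}}" for k
  have S: "finite (S k)" "card (S k) \<le> C" for k
    unfolding S_def using finite_cells C[OF W_bounded W_diameter] by simp_all
  define P where "P = {p \<in> Sigma T (\<lambda>k. S k \<times> I). fst (snd p) ` A (snd (snd p)) \<subseteq> A j}"
  have fin_Sigma: "finite (Sigma T (\<lambda>k. S k \<times> I))" using T(1) S(1) fin by simp
  then have fin_P: "finite P" unfolding P_def by simp
  define M where "M = (\<lambda>p. (\<rho> ^ n (fst p), snd p)) ` P"
  have "finite M" unfolding M_def using fin_P by simp
  moreover have "0 < r \<and> r < 1 \<and> k \<in> {k \<in> I. hausdorff_measure s (A k) = 0} \<and>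
     (\<forall>x y. dist (f x) (f y) \<le> r * dist x y)" if M: "(r, f, k) \<in> M" for r f k
  proof -
    obtain m where m: "m \<in> T" "f \<in> cells (n m)" "k \<in> I" "f ` A k \<subseteq> A j" "r = \<rho> ^ n m"
    proof -
      obtain p where p: "p \<in> P" "(r, f, k) = (\<rho> ^ n (fst p), snd p)"
        using M[unfolded M_def] by auto
      then have "p = (fst p, f, k)" by (cases p) simp
      with p(1) have "fst p \<in> T" "f \<in> S (fst p)" "k \<in> I" "f ` A k \<subseteq> A j"
        unfolding P_def by (metis (no_types, lifting) mem_Collect_eq mem_Sigma_iff fst_conv snd_conv)+
      moreover have "r = \<rho> ^ n (fst p)" using p(2) by simp
      ultimately show thesis by (intro that[of "fst p"]) (simp_all add: S_def)
    qed
    have "0 < r" unfolding m(5) using rho_pos by simp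
    moreover have dist: "dist (f x) (f y) = r * dist x y" for x y
      unfolding m(5) by (rule cell_dist[OF m(2)])
    moreover have "hausdorff_measure s (A k) = 0"
      by (rule hausdorff_null_similar[OF _ m(4) \<open>0 < r\<close> dist null]) (use s in simp)
    ultimately show ?thesis using m(3) small[OF m(1)] m(5) by simp
  qed
  moreover have "A j \<subseteq> (\<Union>(r, f, k)\<in>M. f ` A k)"
  proof
    fix x assume x: "x \<in> A j"
    then obtain m where m: "m \<in> T" "x \<in> W m" using T(2) by auto
    obtain f k where fk: "f \<in> cells (n m)" "k \<in> I" "f ` A k \<subseteq> A j" "x \<in> f ` A k"
      using level_pieces[where A = A and I = I and n = "n m", OF gds j x] by auto
    have "f ` A k \<subseteq> f ` K" using A[OF fk(2)] by (intro image_mono) simp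
    then have "x \<in> f ` K \<inter> W m" using fk(4) m(2) by auto
    then have "f \<in> S m" unfolding S_def using fk(1) by auto
    then have "(m, f, k) \<in> P" unfolding P_def using m(1) fk by simp
    then have "(\<rho> ^ n m, f, k) \<in> M" unfolding M_def by (intro image_eqI) simp_all
    then show "x \<in> (\<Union>(r, f, k)\<in>M. f ` A k)" by (rule UN_I) (simp add: fk(4))
  qed
  moreover have "(\<Sum>(r, f, k)\<in>M. r powr s) \<le> 1"
  proof -
    have "(\<Sum>(r, f, k)\<in>M. r powr s) = (\<Sum>p\<in>M. fst p powr s)" by (simp add: case_prod_beta)
    also have "\<dots> \<le> (\<Sum>p\<in>P. (\<rho> ^ n (fst p)) powr s)"
      unfolding M_def using sum_image_le[OF fin_P, of "\<lambda>p. fst p powr s" "\<lambda>p. (\<rho> ^ n (fst p), snd p)"] by (simp add: o_def)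
    also have "\<dots> \<le> (\<Sum>p\<in>Sigma T (\<lambda>k. S k \<times> I). (\<rho> ^ n (fst p)) powr s)"
      by (rule sum_mono2[OF fin_Sigma]) (simp_all add: P_def)
    also have "\<dots> = (\<Sum>k\<in>T. \<Sum>p\<in>S k \<times> I. (\<rho> ^ n k) powr s)"
      using T(1) S(1) fin by (subst sum.Sigma) (simp_all add: case_prod_beta)
    also have "\<dots> = (\<Sum>k\<in>T. real (card (S k)) * real (card I) * (\<rho> ^ n k) powr s)"
      by (simp add: card_cartesian_product)
    also have "\<dots> \<le> (\<Sum>k\<in>T. c * (\<rho> ^ n k) powr s)"
    proof (intro sum_mono mult_right_mono)
      fix k
      have "real (card (S k)) * real (card I) \<le> real C * real (card I)"
        using S(2) by (intro mult_right_mono) simp_all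
      then show "real (card (S k)) * real (card I) \<le> c" unfolding c_def by simp
    qed simp
    also have "\<dots> = c * (\<Sum>k\<in>T. (\<rho> ^ n k) powr s)" by (rule sum_distrib_left[symmetric])
    also have "\<dots> \<le> c * (1 / c)" using total c by (intro mult_left_mono) simp_all
    also have "\<dots> = 1" using c by simp
    finally show ?thesis .
  qed
  ultimately show ?thesis by (intro exI[of _ M]) (simp add: case_prod_beta split_paired_Ball_Sigma; force)
qed

text \<open>For a given \<open>s\<close> the self-covers use only the members of the family that are null sets in dimension
  \<open>s\<close>; this subfamily is closed under passing to the pieces.\<close>

theorem graph_directed_box_dim_eq_hausdorff_dim:
  fixes A :: "'i \<Rightarrow> 'a set"
  assumes fin: "finite I"
    and A: "\<And>j. j \<in> I \<Longrightarrow> compact (A j) \<and> A j \<subseteq> K \<and> A j \<noteq> {}"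
    and gds: "\<And>j x. j \<in> I \<Longrightarrow> x \<in> A j \<Longrightarrow>
      \<exists>i\<in>{1..N}. \<exists>k\<in>I. F i ` A k \<subseteq> A j \<and> x \<in> F i ` A k"
    and j: "j \<in> I"
  shows "has_box_dim (A j) (hausdorff_dim (A j))"
proof -
  have u: "upper_box_dim (A j) \<le> hausdorff_dim (A j)"
    unfolding hausdorff_dim_def
  proof (rule Inf_greatest, elim imageE, clarify)
    fix s :: real assume "0 \<le> s" and null: "hausdorff_measure s (A j) = 0"
    then have "s \<noteq> 0" using hausdorff_measure_0_pos A[OF j] by auto
    then have s: "0 < s" using \<open>0 \<le> s\<close> by simp
    let ?I = "{k \<in> I. hausdorff_measure s (A k) = 0}"
    have "\<exists>C. \<forall>j\<in>?I. \<forall>\<delta>. 0 < \<delta> \<longrightarrow> \<delta> \<le> 1 \<longrightarrow> real (covering_number (A j) \<delta>) \<le> C * \<delta> powr - s"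
    proof (rule covering_number_le_of_self_cover)
      fix k assume "k \<in> ?I"
      then have k: "k \<in> I" "hausdorff_measure s (A k) = 0" by simp_all
      show "compact (A k)" using A[OF k(1)] by simp
      show "\<exists>M :: (real \<times> ('a \<Rightarrow> 'a) \<times> 'i) set. finite M \<and>
          (\<forall>(r, f, k)\<in>M. 0 < r \<and> r < 1 \<and> k \<in> ?I \<and> (\<forall>x y. dist (f x) (f y) \<le> r * dist x y)) \<and>
          A k \<subseteq> (\<Union>(r, f, k)\<in>M. f ` A k) \<and> (\<Sum>(r, f, k)\<in>M. r powr s) \<le> 1"
        using A by (intro null_set_self_cover[OF fin _ gds s k]) simp_all
    qed (use fin \<open>0 \<le> s\<close> in simp_all)
    then obtain C where C: "\<forall>j\<in>?I. \<forall>\<delta>. 0 < \<delta> \<longrightarrow> \<delta> \<le> 1 \<longrightarrow>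
      real (covering_number (A j) \<delta>) \<le> C * \<delta> powr - s" ..
    have "j \<in> ?I" using j null by simp
    from bspec[OF C this] show "upper_box_dim (A j) \<le> ereal s"
      by (intro upper_box_dim_le[of _ C, OF _ \<open>0 \<le> s\<close>]) simp
  qed
  have h: "hausdorff_dim (A j) \<le> lower_box_dim (A j)"
    using A[OF j] by (intro hausdorff_dim_le_lower_box_dim) simp
  have l: "lower_box_dim (A j) \<le> upper_box_dim (A j)"
    unfolding lower_box_dim_def upper_box_dim_def by (intro Liminf_le_Limsup) simp
  show ?thesis
    unfolding has_box_dim_def
    using antisym[OF order_trans[OF l u] h] antisym[OF u order_trans[OF h l]] by (rule conjI)
qed

end

section \<open>Decomposition of the equivalence classes\<close>

lemma equiv_Inter:
  assumes "\<S> \<noteq> {}" "\<And>S. S \<in> \<S> \<Longrightarrow> equiv A S"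
  shows "equiv A (\<Inter>\<S>)"
proof (rule equivI)
  obtain S where S: "S \<in> \<S>" using assms(1) by auto
  show "\<Inter>\<S> \<subseteq> A \<times> A"
    by (rule order_trans[OF Inter_lower[OF S] equiv_type[OF assms(2)[OF S]]])
  show "refl_on A (\<Inter>\<S>)" using assms(2) unfolding equiv_def refl_on_def by simp
  show "sym (\<Inter>\<S>)" using assms(2) unfolding equiv_def sym_def by simp
  show "trans (\<Inter>\<S>)"
  proof (rule transI)
    fix x y z assume "(x, y) \<in> \<Inter>\<S>" "(y, z) \<in> \<Inter>\<S>"
    then show "(x, z) \<in> \<Inter>\<S>"
      using assms(2) unfolding equiv_def by (intro InterI) (meson InterD transD)
  qed
qed

locale pcf_relation = pcf_ifs +
  fixes R :: "'a rel"
  assumes equiv_R: "equiv V0 R"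
begin

abbreviation "simn \<equiv> sim N F K R"
abbreviation "sims \<equiv> simstar N F K R"
abbreviation "V_star \<equiv> Vstar N F K"
abbreviation "boundary \<equiv> boundary_classes N F K R"
abbreviation "nonboundary \<equiv> nonboundary_classes N F K R"

lemma equiv_simn: "equiv (V N F K n) (simn n)"
proof (induction n)
  case 0 show ?case using equiv_R by simp
next
  case (Suc n)
  let ?S = "{S. equiv (V N F K (Suc n)) S \<and> (\<forall>(x, y)\<in>simn n. (x, y) \<in> S) \<and>
    (\<forall>(x, y)\<in>simn n. \<forall>i\<in>{1..N}. (F i x, F i y) \<in> S)}"
  let ?T = "V N F K (Suc n) \<times> V N F K (Suc n)"
  have n: "x \<in> V N F K n \<and> y \<in> V N F K n" if "(x, y) \<in> simn n" for x y
    using equiv_type[OF Suc] that by auto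
  have "equiv (V N F K (Suc n)) ?T"
    by (rule equivI) (auto simp: refl_on_def sym_def trans_def)
  moreover have "(x, y) \<in> ?T" if "(x, y) \<in> simn n" for x y
    using n[OF that] V_subset_Suc[of n] by (intro SigmaI) (simp_all only: subsetD)
  moreover have "(F i x, F i y) \<in> ?T" if "(x, y) \<in> simn n" "i \<in> {1..N}" for x y i
    using n[OF that(1)] that(2) unfolding V.simps(2) by (intro SigmaI UN_I[of i]) simp_all
  ultimately have "?T \<in> ?S" unfolding mem_Collect_eq 
    by (intro conjI ballI; simp only: split_paired_all prod.case) (intro ballI, simp only: ball_simps)
  then have "?S \<noteq> {}" unfolding ex_in_conv[symmetric] by (rule exI)
  then show ?case unfolding sim.simps(2) by (rule equiv_Inter) simp
qed

lemma simn_Suc: "(x, y) \<in> simn n \<Longrightarrow> (x, y) \<in> simn (Suc n)"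
  by auto

lemma simn_F: "(x, y) \<in> simn n \<Longrightarrow> i \<in> {1..N} \<Longrightarrow> (F i x, F i y) \<in> simn (Suc n)"
  by auto

lemma simn_Suc_least:
  assumes "equiv (V N F K (Suc n)) S" "\<And>x y. (x, y) \<in> simn n \<Longrightarrow> (x, y) \<in> S"
    "\<And>x y i. (x, y) \<in> simn n \<Longrightarrow> i \<in> {1..N} \<Longrightarrow> (F i x, F i y) \<in> S"
  shows "simn (Suc n) \<subseteq> S"
  unfolding sim.simps(2) using assms by (intro Inter_lower) auto

lemma simn_mono: "m \<le> n \<Longrightarrow> simn m \<subseteq> simn n"
  by (rule lift_Suc_mono_le) (auto simp only: simn_Suc intro: simn_Suc)

lemma sims_iff: "(x, y) \<in> sims \<longleftrightarrow> (\<exists>n. (x, y) \<in> simn n)"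
  unfolding simstar_def using equiv_type[OF equiv_simn] by auto

lemma sims_F: "(x, y) \<in> sims \<Longrightarrow> i \<in> {1..N} \<Longrightarrow> (F i x, F i y) \<in> sims"
  unfolding sims_iff using simn_F by meson

lemma equiv_sims: "equiv V_star sims"
proof (rule equivI)
  show "sims \<subseteq> V_star \<times> V_star" unfolding simstar_def Vstar_def by auto
  show "refl_on V_star sims"
    unfolding refl_on_def Vstar_def
  proof
    fix x assume "x \<in> (\<Union>n. V N F K n)"
    then obtain n where "x \<in> V N F K n" by auto
    then have "(x, x) \<in> simn n" using equiv_simn[of n] unfolding equiv_def refl_on_def by simp
    then show "(x, x) \<in> sims" unfolding sims_iff ..
  qed
  show "sym sims"
  proof (rule symI)
    fix x y assume "(x, y) \<in> sims"
    then obtain n where "(x, y) \<in> simn n" unfolding sims_iff ..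
    then have "(y, x) \<in> simn n" using equiv_simn[of n] unfolding equiv_def sym_def by simp
    then show "(y, x) \<in> sims" unfolding sims_iff ..
  qed
  show "trans sims"
  proof (rule transI)
    fix x y z assume "(x, y) \<in> sims" "(y, z) \<in> sims"
    then obtain m n where mn: "(x, y) \<in> simn m" "(y, z) \<in> simn n" unfolding sims_iff by auto
    have "(x, y) \<in> simn (max m n)" "(y, z) \<in> simn (max m n)"
      using subsetD[OF simn_mono[of m "max m n"] mn(1)] subsetD[OF simn_mono[of n "max m n"] mn(2)]
      by (simp_all only: max.cobounded1 max.cobounded2)
    then have "(x, z) \<in> simn (max m n)" using equiv_simn[of "max m n"] unfolding equiv_def by (metis transD)
    then show "(x, z) \<in> sims" unfolding sims_iff ..
  qed
qed

lemma F_V_star: "x \<in> V_star \<Longrightarrow> i \<in> {1..N} \<Longrightarrow> F i x \<in> V_star"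
proof -
  assume "x \<in> V_star" and i: "i \<in> {1..N}"
  then obtain n where "x \<in> V N F K n" unfolding Vstar_def by auto
  then have "F i x \<in> V N F K (Suc n)" unfolding V.simps(2) using i by (intro UN_I[of i] imageI)
  then show "F i x \<in> V_star" unfolding Vstar_def by (rule UN_I[OF UNIV_I])
qed

lemma V_star_subset_K: "V_star \<subseteq> K"
  unfolding Vstar_def using V_subset_K by (rule UN_least)

lemma V_star_split:
  assumes "x \<in> V_star" obtains i y where "i \<in> {1..N}" "y \<in> V_star" "x = F i y"
proof -
  obtain n where "x \<in> V N F K n" using assms unfolding Vstar_def by auto
  then have "x \<in> V N F K (Suc n)" by (rule subsetD[OF V_subset_Suc])
  then obtain i y where "i \<in> {1..N}" "y \<in> V N F K n" "x = F i y" by auto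
  then show thesis using that[of i y] unfolding Vstar_def by auto
qed

lemma class_nonempty: "D \<in> V_star // sims \<Longrightarrow> D \<noteq> {}"
  using equiv_sims by (rule in_quotient_imp_non_empty)

lemma class_subset: "D \<in> V_star // sims \<Longrightarrow> D \<subseteq> V_star"
  using equiv_sims by (rule in_quotient_imp_subset)

lemma class_eqI: "D \<in> V_star // sims \<Longrightarrow> D' \<in> V_star // sims \<Longrightarrow> x \<in> D \<Longrightarrow> x \<in> D' \<Longrightarrow> D = D'"
  using quotient_disj[OF equiv_sims, of D D'] by auto

lemma class_closed: "D \<in> V_star // sims \<Longrightarrow> (x, y) \<in> sims \<Longrightarrow> x \<in> D \<longleftrightarrow> y \<in> D"
  using in_quotient_imp_closed[OF equiv_sims] equivE[OF equiv_sims] by (metis symD)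

lemma class_related: "D \<in> V_star // sims \<Longrightarrow> x \<in> D \<Longrightarrow> y \<in> D \<Longrightarrow> (x, y) \<in> sims"
  using quotient_eq_iff[OF equiv_sims, of D D x y] by simp

lemma class_image_subset:
  assumes "D \<in> V_star // sims" "D' \<in> V_star // sims" "i \<in> {1..N}" "x \<in> D'" "F i x \<in> D"
  shows "F i ` D' \<subseteq> D"
proof (intro subsetI, elim imageE)
  fix z y assume "y \<in> D'" "z = F i y"
  then show "z \<in> D"
    using class_closed[OF assms(1) sims_F[OF class_related[OF assms(2,4)] assms(3)]] assms(5) by simp
qed

lemma boundary_or_nonboundary:
  "D \<in> V_star // sims \<longleftrightarrow> D \<in> boundary \<or> D \<in> nonboundary"
  unfolding boundary_classes_def nonboundary_classes_def by auto

lemma first_level_cell_unique: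
  assumes "i \<in> {1..N}" "j \<in> {1..N}" "x \<in> K" "x \<notin> V0" "y \<in> K" "F i x = F j y"
  shows "i = j \<and> x = y"
proof -
  have "i = j" using first_level_meeting_point_in_V0[OF assms(1,2) _ assms(3,5,6)] assms(4) by auto
  then show ?thesis using F_inj[OF assms(1)] assms(6) by simp
qed

text \<open>The generating pairs of the relation connect points of one first-level cell or points of \<open>V0\<close>.
  As \<open>D\<close> avoids \<open>V0\<close>, the image \<open>F i ` D\<close> avoids \<open>V0\<close> and all other first-level cells, so that no
  generating pair leads out of it.\<close>

lemma nonboundary_image:
  assumes D: "D \<in> nonboundary" and i: "i \<in> {1..N}"
  shows "F i ` D \<in> nonboundary"
proof -
  have DQ: "D \<in> V_star // sims" and D0: "D \<inter> V0 = {}"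
    using D unfolding nonboundary_classes_def by auto
  have DK: "x \<in> K" "x \<notin> V0" if "x \<in> D" for x
    using that D0 class_subset[OF DQ] V_star_subset_K by auto
  have image_iff: "F j y \<in> F i ` D \<longleftrightarrow> j = i \<and> y \<in> D" if j: "j \<in> {1..N}" "y \<in> K" for j y
  proof
    assume "F j y \<in> F i ` D"
    then obtain x where x: "x \<in> D" "F i x = F j y" by auto
    then show "j = i \<and> y \<in> D"
      using first_level_cell_unique[OF i j(1) DK[OF x(1)] j(2) x(2)] by simp
  qed auto
  have avoids: "F i ` D \<inter> V0 = {}"
  proof (rule ccontr)
    assume "F i ` D \<inter> V0 \<noteq> {}"
    then obtain z where z: "z \<in> F i ` D" "z \<in> V0" by auto
    have "z \<in> V N F K (Suc 0)" using z(2) by (rule subsetD[OF V_subset_Suc])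
    then have "z \<in> (\<Union>j\<in>{1..N}. F j ` V0)" by (simp only: V.simps(2))
    then obtain j y where "j \<in> {1..N}" "y \<in> V0" "z = F j y" by (elim UN_E imageE)
    moreover from this have "y \<in> K" using subsetD[OF V_subset_K[of 0]] by simp
    ultimately show False using image_iff[of j y] z(1) D0 by auto
  qed
  have closed: "x \<in> F i ` D \<longleftrightarrow> y \<in> F i ` D" if "(x, y) \<in> simn n" for x y n
    using that
  proof (induction n arbitrary: x y)
    case 0
    then have "x \<in> V0" "y \<in> V0" using equiv_type[OF equiv_simn[of 0]] by auto
    then show ?case using avoids by auto
  next
    case (Suc n)
    let ?S = "{(x, y). x \<in> V N F K (Suc n) \<and> y \<in> V N F K (Suc n) \<and> (x \<in> F i ` D \<longleftrightarrow> y \<in> F i ` D)}"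
    have "simn (Suc n) \<subseteq> ?S"
    proof (rule simn_Suc_least)
      show "equiv (V N F K (Suc n)) ?S"
        by (rule equivI) (simp_all add: refl_on_def sym_def trans_def subset_iff)
      fix x y assume xy: "(x, y) \<in> simn n"
      then have V: "x \<in> V N F K n" "y \<in> V N F K n" using equiv_type[OF equiv_simn[of n]] by auto
      show "(x, y) \<in> ?S"
        using subsetD[OF V_subset_Suc V(1)] subsetD[OF V_subset_Suc V(2)] Suc.IH[OF xy] by simp
      fix j assume j: "j \<in> {1..N}"
      have K: "x \<in> K" "y \<in> K" using V V_subset_K[of n] by auto
      have "F j x \<in> V N F K (Suc n)" "F j y \<in> V N F K (Suc n)"
        unfolding V.simps(2) using V j by (auto simp only: intro!: UN_I[of j] imageI)
      moreover have "F j x \<in> F i ` D \<longleftrightarrow> F j y \<in> F i ` D"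
        unfolding image_iff[OF j K(1)] image_iff[OF j K(2)]
        using class_closed[OF DQ, of x y] xy sims_iff by auto
      ultimately show "(F j x, F j y) \<in> ?S" by simp
    qed
    then show ?case using Suc.prems by auto
  qed
  obtain x where x: "x \<in> D" using class_nonempty[OF DQ] by auto
  have "F i ` D = sims `` {F i x}"
  proof
    show "F i ` D \<subseteq> sims `` {F i x}"
      using sims_F[OF class_related[OF DQ x] i] by auto
    show "sims `` {F i x} \<subseteq> F i ` D"
    proof
      fix y assume "y \<in> sims `` {F i x}"
      then obtain n where "(F i x, y) \<in> simn n" unfolding Image_singleton_iff sims_iff ..
      then show "y \<in> F i ` D" using closed imageI[OF x, of "F i"] by simp
    qed
  qed
  moreover have "F i x \<in> V_star" using F_V_star i subsetD[OF class_subset[OF DQ] x] by simp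
  ultimately have "F i ` D \<in> V_star // sims" by (simp add: quotientI)
  then show ?thesis using avoids unfolding nonboundary_classes_def by simp
qed

text \<open>A point \<open>F i y\<close> of \<open>D\<close> carries the image under \<open>F i\<close> of the class of \<open>y\<close> into \<open>D\<close>. If that class is
  non-boundary, its image is a whole class and hence all of \<open>D\<close>.\<close>

lemma class_decomposition:
  assumes D: "D \<in> V_star // sims"
  shows "(\<exists>i\<in>{1..N}. \<exists>D'\<in>nonboundary. D = F i ` D') \<or>
    (\<forall>x\<in>D. \<exists>i\<in>{1..N}. \<exists>B\<in>boundary. F i ` B \<subseteq> D \<and> x \<in> F i ` B)"
proof -
  have "(\<exists>i\<in>{1..N}. \<exists>D'\<in>nonboundary. D = F i ` D') \<or>
    (\<exists>i\<in>{1..N}. \<exists>B\<in>boundary. F i ` B \<subseteq> D \<and> x \<in> F i ` B)" if x: "x \<in> D" for x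
  proof -
    obtain i y where iy: "i \<in> {1..N}" "y \<in> V_star" "x = F i y"
      by (rule V_star_split[OF subsetD[OF class_subset[OF D] x]], rule that)
    let ?B = "sims `` {y}"
    have B: "?B \<in> V_star // sims" using iy(2) by (rule quotientI)
    have y: "y \<in> ?B" using equiv_sims iy(2) by (rule equiv_class_self)
    have sub: "F i ` ?B \<subseteq> D" using class_image_subset[OF D B iy(1) y] x iy(3) by simp
    have xB: "x \<in> F i ` ?B" unfolding iy(3) using y by (rule imageI)
    show ?thesis
    proof (cases "?B \<in> boundary")
      case True
      then show ?thesis using iy(1) sub xB by (intro disjI2 bexI[of _ i] bexI[of _ ?B] conjI)
    next
      case False
      then have nb: "?B \<in> nonboundary" using B unfolding boundary_or_nonboundary by simp
      then have "F i ` ?B \<in> V_star // sims"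
        using nonboundary_image[OF nb iy(1)] unfolding boundary_or_nonboundary by simp
      then have "D = F i ` ?B" using D x xB by (intro class_eqI[of D])
      then show ?thesis using iy(1) nb by (intro disjI1 bexI[of _ i] bexI[of _ ?B])
    qed
  qed
  then show ?thesis by meson
qed

lemma boundary_class_pieces:
  assumes "D \<in> boundary" "x \<in> D"
  shows "\<exists>i\<in>{1..N}. \<exists>B\<in>boundary. F i ` B \<subseteq> D \<and> x \<in> F i ` B"
proof -
  have "D \<notin> nonboundary" "D \<in> V_star // sims"
    using assms(1) unfolding boundary_classes_def nonboundary_classes_def by auto
  then show ?thesis
    using class_decomposition[of D] nonboundary_image assms(2) by auto
qed

lemma finite_boundary: "finite boundary"
proof -
  have "boundary \<subseteq> (\<lambda>x. sims `` {x}) ` V0"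
  proof
    fix D assume "D \<in> boundary"
    then obtain x where D: "D \<in> V_star // sims" and x: "x \<in> D" "x \<in> V0"
      unfolding boundary_classes_def by auto
    have "x \<in> V_star" using class_subset[OF D] x(1) by auto
    then have "D = sims `` {x}"
      using class_eqI[OF D quotientI x(1) equiv_class_self[OF equiv_sims]] by simp
    then show "D \<in> (\<lambda>x. sims `` {x}) ` V0" using x(2) by (rule image_eqI)
  qed
  moreover have "finite V0" using pcf_K unfolding pcf_def by simp
  ultimately show ?thesis by (meson finite_imageI finite_subset)
qed

lemma contractive_similitude_comp:
  fixes f g :: "'a \<Rightarrow> 'a"
  assumes "contractive_similitude f" "contractive_similitude g"
  shows "contractive_similitude (f \<circ> g)"
proof -
  obtain r where r: "0 < r" "r < 1" "\<And>x y. dist (f x) (f y) = r * dist x y"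
    using assms(1) unfolding contractive_similitude_def by auto
  obtain q where q: "0 < q" "q < 1" "\<And>x y. dist (g x) (g y) = q * dist x y"
    using assms(2) unfolding contractive_similitude_def by auto
  have "r * q < 1" using r q mult_strict_mono[of r 1 q 1] by simp
  then show ?thesis
    unfolding contractive_similitude_def using r q by (intro exI[of _ "r * q"]) simp
qed

text \<open>A non-boundary class is peeled, \<open>D = F i ` D'\<close>, until it is a union of images of boundary classes.
  Peeling ends because \<open>D'\<close> meets \<open>V n\<close> if \<open>D\<close> meets \<open>V (n + 1)\<close>, and no non-boundary class
  meets \<open>V 0\<close>.\<close>

lemma nonboundary_class_finite_union:
  assumes "D \<in> nonboundary"
  shows "\<exists>M :: (('a \<Rightarrow> 'a) \<times> 'a set) set. finite M \<and> (\<forall>(f, B)\<in>M. contractive_similitude f \<and> B \<in> boundary) \<and>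
    D = (\<Union>(f, B)\<in>M. f ` B)"
proof -
  have Q: "D \<in> V_star // sims" using assms unfolding boundary_or_nonboundary by simp
  obtain x where "x \<in> D" using class_nonempty[OF Q] by auto
  then have "x \<in> V_star" using class_subset[OF Q] by auto
  then obtain n where "x \<in> V N F K n" unfolding Vstar_def by auto
  with \<open>x \<in> D\<close> have "D \<inter> V N F K n \<noteq> {}" by auto
  then show ?thesis using assms
  proof (induction n arbitrary: D)
    case 0
    then show ?case unfolding nonboundary_classes_def by simp
  next
    case (Suc n)
    have Q: "D \<in> V_star // sims" using Suc.prems(2) unfolding boundary_or_nonboundary by simp
    from class_decomposition[OF Q] show ?case
    proof (elim disjE bexE)
      fix i D' assume i: "i \<in> {1..N}" and D': "D' \<in> nonboundary" and D: "D = F i ` D'"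
      obtain z where z: "z \<in> D" "z \<in> V N F K (Suc n)" using Suc.prems(1) by auto
      obtain x where x: "x \<in> D'" "z = F i x" using z(1) D by auto
      have "z \<in> (\<Union>j\<in>{1..N}. F j ` V N F K n)" using z(2) by (simp only: V.simps(2))
      then obtain j y where jy: "j \<in> {1..N}" "y \<in> V N F K n" "z = F j y" by (elim UN_E imageE)
      have "D' \<in> V_star // sims" using D' unfolding boundary_or_nonboundary by simp
      then have "x \<in> K" using class_subset V_star_subset_K x(1) by blast
      moreover have "x \<notin> V0" using D' x(1) unfolding nonboundary_classes_def by auto
      moreover have "y \<in> K" using jy(2) V_subset_K[of n] by auto
      ultimately have "x = y" using first_level_cell_unique[OF i jy(1)] x(2) jy(3) by simp
      then have "D' \<inter> V N F K n \<noteq> {}" using x(1) jy(2) by auto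
      from Suc.IH[OF this D'] obtain M :: "(('a \<Rightarrow> 'a) \<times> 'a set) set" where
        M: "finite M" "\<forall>(f, B)\<in>M. contractive_similitude f \<and> B \<in> boundary"
          "D' = (\<Union>(f, B)\<in>M. f ` B)" by auto
      let ?M = "(\<lambda>(f, B). (F i \<circ> f, B)) ` M"
      have "finite ?M" using M(1) by simp
      moreover have "\<forall>(f, B)\<in>?M. contractive_similitude f \<and> B \<in> boundary"
        using M(2) contractive_similitude_comp[OF F_similitude[OF i]] by auto
      moreover have "D = (\<Union>(f, B)\<in>?M. f ` B)"
        unfolding D M(3) by (simp add: image_UN case_prod_beta image_image)
      ultimately show ?thesis by (intro exI[of _ ?M] conjI)
    next
      assume pieces: "\<forall>x\<in>D. \<exists>i\<in>{1..N}. \<exists>B\<in>boundary. F i ` B \<subseteq> D \<and> x \<in> F i ` B"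
      let ?M = "{p \<in> F ` {1..N} \<times> boundary. fst p ` snd p \<subseteq> D}"
      have "finite ?M" using finite_boundary by simp
      moreover have "\<forall>(f, B)\<in>?M. contractive_similitude f \<and> B \<in> boundary"
        using F_similitude by auto
      moreover have "D = (\<Union>(f, B)\<in>?M. f ` B)"
      proof
        show "D \<subseteq> (\<Union>(f, B)\<in>?M. f ` B)"
        proof
          fix x assume "x \<in> D"
          with pieces obtain i B where "i \<in> {1..N}" "B \<in> boundary" "F i ` B \<subseteq> D" "x \<in> F i ` B"
            by meson
          then show "x \<in> (\<Union>(f, B)\<in>?M. f ` B)" by (intro UN_I[of "(F i, B)"]) simp_all
        qed
        show "(\<Union>(f, B)\<in>?M. f ` B) \<subseteq> D" by (rule UN_least) (simp add: case_prod_beta)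
      qed
      ultimately show ?thesis by (intro exI[of _ ?M] conjI)
    qed
  qed
qed

end

section \<open>Attractors of the boundary classes\<close>

context pcf_relation
begin

lemma boundary_class_subset_K: "D \<in> boundary \<Longrightarrow> D \<subseteq> K"
  using class_subset[of D] V_star_subset_K unfolding boundary_classes_def by auto

lemma boundary_class_closure:
  assumes "D \<in> boundary"
  shows "compact (closure D)" "closure D \<subseteq> K" "closure D \<noteq> {}"
proof -
  show sub: "closure D \<subseteq> K"
    by (rule closure_minimal[OF boundary_class_subset_K[OF assms] compact_imp_closed[OF K_compact]])
  show "compact (closure D)"
    unfolding compact_closure
    by (rule bounded_subset[OF compact_imp_bounded[OF K_compact] boundary_class_subset_K[OF assms]])
  show "closure D \<noteq> {}"
    using assms unfolding boundary_classes_def by auto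
qed

lemma closure_image_subset:
  assumes "i \<in> {1..N}" "F i ` B \<subseteq> D" shows "F i ` closure B \<subseteq> closure D"
proof -
  have "F i ` closure B \<subseteq> closure (F i ` B)"
    by (rule image_closure_subset[OF F_continuous[OF assms(1)] closed_closure closure_subset])
  then show ?thesis using closure_mono[OF assms(2)] by (rule order_trans)
qed

text \<open>The pieces of a boundary class are finite in number and their closures are compact, so that the
  decomposition passes to the closure.\<close>

lemma closure_boundary_class_pieces:
  assumes D: "D \<in> boundary"
  shows "closure D = (\<Union>B\<in>boundary. \<Union>i\<in>{i \<in> {1..N}. F i ` B \<subseteq> D}. F i ` closure B)"
    (is "_ = ?U")
proof
  have "compact (F i ` closure B)" if "i \<in> {1..N}" "B \<in> boundary" for i B
    by (rule compact_continuous_image[OF F_continuous[OF that(1)] boundary_class_closure(1)[OF that(2)]])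
  then have "compact ?U" using finite_boundary by (intro compact_UN) simp_all
  moreover have "D \<subseteq> ?U"
  proof
    fix x assume "x \<in> D"
    then obtain i B where iB: "i \<in> {1..N}" "B \<in> boundary" "F i ` B \<subseteq> D" "x \<in> F i ` B"
      using boundary_class_pieces[OF D] by meson
    have "x \<in> F i ` closure B" by (rule subsetD[OF image_mono[OF closure_subset] iB(4)])
    then show "x \<in> ?U" using iB by (intro UN_I[of B] UN_I[of i]) simp_all
  qed
  ultimately show "closure D \<subseteq> ?U" by (intro closure_minimal compact_imp_closed)
  show "?U \<subseteq> closure D"
    using closure_image_subset by (intro UN_least) simp
qed

end

theorem theorem3p2:
  fixes N s :: nat
    and \<rho> :: real
    and b :: "nat \<Rightarrow> 'a::euclidean_space"
    and F :: "nat \<Rightarrow> 'a \<Rightarrow> 'a"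
    and K :: "'a set"
    and R :: "'a rel"
    and J Jstar :: "nat \<Rightarrow> 'a set"
  assumes "0 < \<rho>" and "\<rho> < 1"
    and "\<And>i x. i \<in> {1..N} \<Longrightarrow> F i x = \<rho> *\<^sub>R (x - b i) + b i"
    and "self_similar_set N F K"
    and "connected K"
    and "pcf N F K"
    and "card (V N F K 0) \<ge> 2"
    and "compatible N F K R"
    and "bij_betw J {1..s} (V N F K 0 // R)"
    and "\<And>i. i \<in> {1..s} \<Longrightarrow> Jstar i \<in> boundary_classes N F K R \<and> J i \<subseteq> Jstar i"
  shows "(\<exists>\<Gamma> f. graph_directed_system s \<Gamma> f \<and> gds_attractors s \<Gamma> f (\<lambda>i. closure (Jstar i)))
    \<and> (\<forall>i\<in>{1..s}. has_box_dim (closure (Jstar i)) (hausdorff_dim (closure (Jstar i))))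
    \<and> (\<forall>D\<in>nonboundary_classes N F K R.
         \<exists>M :: (('a \<Rightarrow> 'a) \<times> nat) set. finite M
           \<and> (\<forall>(f, i)\<in>M. contractive_similitude f \<and> i \<in> {1..s})
           \<and> D = (\<Union>(f, i)\<in>M. f ` Jstar i))"
proof -
  have equiv: "equiv (V N F K 0) R" using assms(8) unfolding compatible_def by simp
  interpret pcf_relation N \<rho> b F K R
    by unfold_locales (fact assms(1-4) assms(6) equiv)+
  have Jstar: "Jstar i \<in> boundary" if "i \<in> {1..s}" for i
    using assms(10)[OF that] by simp
  have boundary_eq: "boundary = Jstar ` {1..s}"
  proof
    show "Jstar ` {1..s} \<subseteq> boundary" using Jstar by auto
    show "boundary \<subseteq> Jstar ` {1..s}"
    proof
      fix D assume D: "D \<in> boundary"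
      then obtain x where x: "x \<in> D" "x \<in> V0" unfolding boundary_classes_def by auto
      have "R `` {x} \<in> J ` {1..s}"
        using quotientI[OF x(2), of R] bij_betw_imp_surj_on[OF assms(9)] by simp
      then obtain i where i: "i \<in> {1..s}" "J i = R `` {x}" by auto
      have "x \<in> J i" unfolding i(2) using equiv_class_self[OF equiv x(2)] .
      then have "x \<in> Jstar i" using assms(10)[OF i(1)] by auto
      then have "D = Jstar i"
        using class_eqI[of D "Jstar i" x] x(1) D Jstar[OF i(1)] boundary_or_nonboundary by simp
      then show "D \<in> Jstar ` {1..s}" using i(1) by (rule image_eqI)
    qed
  qed
  define \<Gamma> where "\<Gamma> i j = {k \<in> {1..N}. F k ` Jstar j \<subseteq> Jstar i}" for i j
  have attractor: "closure (Jstar i) = (\<Union>j\<in>{1..s}. \<Union>k\<in>\<Gamma> i j. F k ` closure (Jstar j))"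
    if "i \<in> {1..s}" for i
    unfolding \<Gamma>_def closure_boundary_class_pieces[OF Jstar[OF that]]
    unfolding boundary_eq image_image by simp
  have "graph_directed_system s \<Gamma> F"
    unfolding graph_directed_system_def \<Gamma>_def using F_similitude by simp
  moreover have "gds_attractors s \<Gamma> F (\<lambda>i. closure (Jstar i))"
    unfolding gds_attractors_def
    using boundary_class_closure(1,3)[OF Jstar] attractor by (intro ballI conjI)
  moreover have "has_box_dim (closure (Jstar i)) (hausdorff_dim (closure (Jstar i)))"
    if i: "i \<in> {1..s}" for i
  proof (rule graph_directed_box_dim_eq_hausdorff_dim[where I = "{1..s}"])
    fix j assume j: "j \<in> {1..s}"
    show "compact (closure (Jstar j)) \<and> closure (Jstar j) \<subseteq> K \<and> closure (Jstar j) \<noteq> {}"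
      using boundary_class_closure[OF Jstar[OF j]] by (intro conjI)
    fix x assume "x \<in> closure (Jstar j)"
    then have "x \<in> (\<Union>k\<in>{1..s}. \<Union>i\<in>\<Gamma> j k. F i ` closure (Jstar k))"
      by (simp only: attractor[OF j])
    then obtain k i where ki: "k \<in> {1..s}" "i \<in> \<Gamma> j k" "x \<in> F i ` closure (Jstar k)"
      by (elim UN_E)
    then have "i \<in> {1..N}" "F i ` Jstar k \<subseteq> Jstar j" unfolding \<Gamma>_def by simp_all
    then show "\<exists>i\<in>{1..N}. \<exists>k\<in>{1..s}. F i ` closure (Jstar k) \<subseteq> closure (Jstar j) \<and> x \<in> F i ` closure (Jstar k)"
      using ki closure_image_subset[of i "Jstar k" "Jstar j"]
      by (intro bexI[of _ i] bexI[of _ k] conjI)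
  qed (use i in simp_all)
  moreover have "\<exists>M :: (('a \<Rightarrow> 'a) \<times> nat) set. finite M
           \<and> (\<forall>(f, i)\<in>M. contractive_similitude f \<and> i \<in> {1..s})
           \<and> D = (\<Union>(f, i)\<in>M. f ` Jstar i)" if D: "D \<in> nonboundary" for D
  proof -
    from nonboundary_class_finite_union[OF D] obtain M :: "(('a \<Rightarrow> 'a) \<times> 'a set) set" where
      M: "finite M" "\<forall>(f, B)\<in>M. contractive_similitude f \<and> B \<in> boundary"
        "D = (\<Union>(f, B)\<in>M. f ` B)" by auto
    have "\<forall>B\<in>boundary. \<exists>i. i \<in> {1..s} \<and> Jstar i = B" unfolding boundary_eq by auto
    from bchoice[OF this] obtain h where h: "\<forall>B\<in>boundary. h B \<in> {1..s} \<and> Jstar (h B) = B" ..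
    let ?M = "(\<lambda>(f, B). (f, h B)) ` M"
    have "finite ?M" using M(1) by simp
    moreover have "\<forall>(f, i)\<in>?M. contractive_similitude f \<and> i \<in> {1..s}"
      using M(2) h by (simp add: case_prod_beta)
    moreover have "D = (\<Union>(f, i)\<in>?M. f ` Jstar i)"
    proof -
      have "(\<Union>(f, i)\<in>?M. f ` Jstar i) = (\<Union>(f, B)\<in>M. f ` Jstar (h B))"
        by (simp add: case_prod_beta image_image)
      also have "\<dots> = (\<Union>(f, B)\<in>M. f ` B)"
      proof -
        have "Jstar (h (snd p)) = snd p" if "p \<in> M" for p
          using M(2) h that by (simp add: case_prod_beta)
        then show ?thesis by (intro SUP_cong) (simp_all add: case_prod_beta)
      qed
      finally show ?thesis using M(3) by simp
    qed
    ultimately show ?thesis by (intro exI[of _ ?M] conjI)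
  qed
  ultimately show ?thesis by (intro conjI ballI exI[of _ \<Gamma>] exI[of _ F])
qed

end
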